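(* Let $X$ be a symmetric space on $[0,1]$ and let $\varDelta=\bigl(\bigoplus_{k=1}^\infty E_k\bigr)_{\ell^1}$ be an $\ell^1$-sum of finite-dimensional Banach spaces, regarded as a Banach sequence space in which the standard unit vectors form a basis. Then no frame in $X$ with respect to $\varDelta$ is projective.
   Context: A symmetric space $X$ on $[0,1]$ is a Banach space of (equivalence classes of) real-valued Lebesgue measurable functions on $[0,1]$ such that: (a) if $y\in X$ and $x$ is measurable with $|x|\le|y|$ a.e., then $x\in X$ and $\|x\|_X\le\|y\|_X$; (b) if $x,y$ are equimeasurable and $y\in X$, then $x\in X$ and $\|x\|_X=\|y\|_X$; normalized so that $\|\chi_{[0,1]}\|_X=1$. Here each $E_k$ is $\mathbb{R}^{d_k}$ with some norm; elements of $\varDelta$ are sequences obtained by concatenating blocks $\xi^{(k)}\in E_k$, with norm $\sum_k\|\xi^{(k)}\|_{E_k}$. For a Banach sequence space $\varDelta$ in which the unit vectors $\delta_n$ form a basis, $\varDelta^*$ is identified with sequences $\eta$ with $\|\eta\|_{\varDelta^*}=\sup_{\|\xi\|_\varDelta\le1}|\sum_n\xi_n\eta_n|$. A sequence $\{x_n\}$ of nonzero elements of a Banach space $X$ is a frame in $X$ with respect to $\varDelta$ if there are $0<A\le B<\infty$ with $A\|y\|_{X^*}\le\|\{\langle x_n,y\rangle\}_n\|_{\varDelta^*}\le B\|y\|_{X^*}$ for all $y\in X^*$. Such a frame is projective if there exist a Banach space $Y$ and a basis $\{e_n\}$ of $X\times Y$ equivalent to the unit vector basis $\{\delta_n\}$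 of $\varDelta$ such that $x_n=Pe_n$ for all $n$, where $P:X\times Y\to X$ is the canonical projection. *)

theory Defs
  imports "HOL-Analysis.Analysis"
begin

text \<open>Lebesgue measure on [0,1]. Elements of a function space are represented by
  real-valued functions on the reals; only their values on [0,1] matter, and
  two representatives denote the same element iff they agree a.e. on [0,1].\<close>

definition M01 :: "real measure" where
  "M01 = lebesgue_on {0..1}"

definition equimeasurable :: "(real \<Rightarrow> real) \<Rightarrow> (real \<Rightarrow> real) \<Rightarrow> bool" where
  "equimeasurable x y \<longleftrightarrow>
     (\<forall>\<tau>::real. emeasure M01 {t \<in> space M01. x t > \<tau>} = emeasure M01 {t \<in> space M01. y t > \<tau>})"

text \<open>A symmetric (rearrangement-invariant) Banach function space on [0,1], given by
  a set X of representatives and a norm N (a seminorm on representatives whose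
  kernel is exactly the a.e.-zero functions).\<close>

definition symmetric_space :: "(real \<Rightarrow> real) set \<Rightarrow> ((real \<Rightarrow> real) \<Rightarrow> real) \<Rightarrow> bool" where
  "symmetric_space X N \<longleftrightarrow>
     \<comment> \<open>measurable functions\<close>
     (\<forall>x\<in>X. x \<in> borel_measurable M01) \<and>
     \<comment> \<open>vector space\<close>
     (\<lambda>t. 0) \<in> X \<and>
     (\<forall>x\<in>X. \<forall>y\<in>X. (\<lambda>t. x t + y t) \<in> X) \<and>
     (\<forall>x\<in>X. \<forall>c::real. (\<lambda>t. c * x t) \<in> X) \<and>
     \<comment> \<open>norm\<close>
     (\<forall>x\<in>X. 0 \<le> N x) \<and>
     (\<forall>x\<in>X. N x = 0 \<longleftrightarrow> (AE t in M01. x t = 0)) \<and>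
     (\<forall>x\<in>X. \<forall>y\<in>X. N (\<lambda>t. x t + y t) \<le> N x + N y) \<and>
     (\<forall>x\<in>X. \<forall>c::real. N (\<lambda>t. c * x t) = \<bar>c\<bar> * N x) \<and>
     \<comment> \<open>completeness\<close>
     (\<forall>s::nat \<Rightarrow> real \<Rightarrow> real. (\<forall>n. s n \<in> X) \<and>
        (\<forall>\<epsilon>>0. \<exists>K. \<forall>m\<ge>K. \<forall>n\<ge>K. N (\<lambda>t. s m t - s n t) < \<epsilon>) \<longrightarrow>
        (\<exists>l\<in>X. (\<lambda>n. N (\<lambda>t. s n t - l t)) \<longlonglongrightarrow> 0)) \<and>
     \<comment> \<open>(a) ideal property\<close>
     (\<forall>y\<in>X. \<forall>x \<in> borel_measurable M01.
        (AE t in M01. \<bar>x t\<bar> \<le> \<bar>y t\<bar>) \<longrightarrow> x \<in> X \<and> N x \<le> N y) \<and>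
     \<comment> \<open>(b) rearrangement invariance\<close>
     (\<forall>y\<in>X. \<forall>x \<in> borel_measurable M01.
        equimeasurable x y \<longrightarrow> x \<in> X \<and> N x = N y) \<and>
     \<comment> \<open>normalisation\<close>
     (indicator {0..1} :: real \<Rightarrow> real) \<in> X \<and> N (indicator {0..1}) = 1"

definition dualX :: "(real \<Rightarrow> real) set \<Rightarrow> ((real \<Rightarrow> real) \<Rightarrow> real) \<Rightarrow> ((real \<Rightarrow> real) \<Rightarrow> real) set" where
  "dualX X N = {y. (\<forall>a\<in>X. \<forall>b\<in>X. y (\<lambda>t. a t + b t) = y a + y b) \<and>
                   (\<forall>a\<in>X. \<forall>c::real. y (\<lambda>t. c * a t) = c * y a) \<and>
                   (\<exists>C. \<forall>a\<in>X. \<bar>y a\<bar> \<le> C * N a)}"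

definition dual_normX :: "(real \<Rightarrow> real) set \<Rightarrow> ((real \<Rightarrow> real) \<Rightarrow> real) \<Rightarrow> ((real \<Rightarrow> real) \<Rightarrow> real) \<Rightarrow> real" where
  "dual_normX X N y = Sup {\<bar>y a\<bar> | a. a \<in> X \<and> N a \<le> 1}"

text \<open>E_k = R^(d k) with norm \<nu> k; vectors of E_k are functions nat \<Rightarrow> real, of which
  only the entries with index < d k matter.\<close>

definition is_norm_Rn :: "nat \<Rightarrow> ((nat \<Rightarrow> real) \<Rightarrow> real) \<Rightarrow> bool" where
  "is_norm_Rn n \<nu> \<longleftrightarrow>
     (\<forall>v w. (\<forall>i<n. v i = w i) \<longrightarrow> \<nu> v = \<nu> w) \<and>
     (\<forall>v. 0 \<le> \<nu> v) \<and>
     (\<forall>v. \<nu> v = 0 \<longleftrightarrow> (\<forall>i<n. v i = 0)) \<and>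
     (\<forall>v w. \<nu> (\<lambda>i. v i + w i) \<le> \<nu> v + \<nu> w) \<and>
     (\<forall>c v. \<nu> (\<lambda>i. c * v i) = \<bar>c\<bar> * \<nu> v)"

text \<open>Admissible block data: every E_k is normed, and infinitely many blocks are
  nontrivial so that the concatenation of the blocks indexes all of nat.\<close>

definition block_data :: "(nat \<Rightarrow> nat) \<Rightarrow> (nat \<Rightarrow> (nat \<Rightarrow> real) \<Rightarrow> real) \<Rightarrow> bool" where
  "block_data d \<nu> \<longleftrightarrow> (\<forall>k. is_norm_Rn (d k) (\<nu> k)) \<and> infinite {k. 0 < d k}"

definition block_offset :: "(nat \<Rightarrow> nat) \<Rightarrow> nat \<Rightarrow> nat" where
  "block_offset d k = (\<Sum>j<k. d j)"

definition block :: "(nat \<Rightarrow> nat) \<Rightarrow> (nat \<Rightarrow> real) \<Rightarrow> nat \<Rightarrow> (nat \<Rightarrow> real)" where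
  "block d \<xi> k = (\<lambda>i. \<xi> (block_offset d k + i))"

definition Delta :: "(nat \<Rightarrow> nat) \<Rightarrow> (nat \<Rightarrow> (nat \<Rightarrow> real) \<Rightarrow> real) \<Rightarrow> (nat \<Rightarrow> real) set" where
  "Delta d \<nu> = {\<xi>. summable (\<lambda>k. \<nu> k (block d \<xi> k))}"

definition normD :: "(nat \<Rightarrow> nat) \<Rightarrow> (nat \<Rightarrow> (nat \<Rightarrow> real) \<Rightarrow> real) \<Rightarrow> (nat \<Rightarrow> real) \<Rightarrow> real" where
  "normD d \<nu> \<xi> = (\<Sum>k. \<nu> k (block d \<xi> k))"

text \<open>Dual norm of an arbitrary real sequence (possibly infinite), computed against the
  dense subspace of finitely supported sequences of Delta.\<close>

definition dual_normD :: "(nat \<Rightarrow> nat) \<Rightarrow> (nat \<Rightarrow> (nat \<Rightarrow> real) \<Rightarrow> real) \<Rightarrow> (nat \<Rightarrow> real) \<Rightarrow> ereal" where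
  "dual_normD d \<nu> \<eta> =
     (SUP p \<in> {(m, \<xi>). (\<forall>i\<ge>m. \<xi> i = 0) \<and> normD d \<nu> \<xi> \<le> 1}.
        ereal \<bar>\<Sum>i<fst p. snd p i * \<eta> i\<bar>)"

definition is_frame ::
  "(real \<Rightarrow> real) set \<Rightarrow> ((real \<Rightarrow> real) \<Rightarrow> real) \<Rightarrow> (nat \<Rightarrow> nat) \<Rightarrow> (nat \<Rightarrow> (nat \<Rightarrow> real) \<Rightarrow> real)
     \<Rightarrow> (nat \<Rightarrow> real \<Rightarrow> real) \<Rightarrow> bool" where
  "is_frame X N d \<nu> x \<longleftrightarrow>
     (\<forall>n. x n \<in> X \<and> N (x n) \<noteq> 0) \<and>
     (\<exists>A B. 0 < A \<and> A \<le> B \<and>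
        (\<forall>y \<in> dualX X N.
           ereal (A * dual_normX X N y) \<le> dual_normD d \<nu> (\<lambda>n. y (x n)) \<and>
           dual_normD d \<nu> (\<lambda>n. y (x n)) \<le> ereal (B * dual_normX X N y)))"

definition normXY :: "((real \<Rightarrow> real) \<Rightarrow> real) \<Rightarrow> (real \<Rightarrow> real) \<times> 'y::real_normed_vector \<Rightarrow> real" where
  "normXY N z = N (fst z) + norm (snd z)"

definition diffXY :: "(real \<Rightarrow> real) \<times> 'y::real_normed_vector \<Rightarrow> (real \<Rightarrow> real) \<times> 'y \<Rightarrow> (real \<Rightarrow> real) \<times> 'y" where
  "diffXY z w = ((\<lambda>t. fst z t - fst w t), snd z - snd w)"

definition psumXY :: "(nat \<Rightarrow> (real \<Rightarrow> real) \<times> 'y::real_normed_vector) \<Rightarrow> (nat \<Rightarrow> real) \<Rightarrow> nat \<Rightarrow> (real \<Rightarrow> real) \<times> 'y" where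
  "psumXY e a m = ((\<lambda>t. \<Sum>n<m. a n * fst (e n) t), (\<Sum>n<m. a n *\<^sub>R snd (e n)))"

definition series_XY ::
  "((real \<Rightarrow> real) \<Rightarrow> real) \<Rightarrow> (nat \<Rightarrow> (real \<Rightarrow> real) \<times> 'y::real_normed_vector) \<Rightarrow> (nat \<Rightarrow> real) \<Rightarrow> (real \<Rightarrow> real) \<times> 'y \<Rightarrow> bool" where
  "series_XY N e a z \<longleftrightarrow> (\<lambda>m. normXY N (diffXY z (psumXY e a m))) \<longlonglongrightarrow> 0"

definition is_basis_XY ::
  "(real \<Rightarrow> real) set \<Rightarrow> ((real \<Rightarrow> real) \<Rightarrow> real) \<Rightarrow> (nat \<Rightarrow> (real \<Rightarrow> real) \<times> 'y::real_normed_vector) \<Rightarrow> bool" where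
  "is_basis_XY X N e \<longleftrightarrow>
     (\<forall>n. fst (e n) \<in> X) \<and>
     (\<forall>z. fst z \<in> X \<longrightarrow> (\<exists>!a. series_XY N e a z))"

definition series_Delta_conv :: "(nat \<Rightarrow> nat) \<Rightarrow> (nat \<Rightarrow> (nat \<Rightarrow> real) \<Rightarrow> real) \<Rightarrow> (nat \<Rightarrow> real) \<Rightarrow> bool" where
  "series_Delta_conv d \<nu> a \<longleftrightarrow>
     (\<exists>\<xi> \<in> Delta d \<nu>. (\<lambda>m. normD d \<nu> (\<lambda>i. \<xi> i - (if i < m then a i else 0))) \<longlonglongrightarrow> 0)"

definition equiv_unit_basis ::
  "(real \<Rightarrow> real) set \<Rightarrow> ((real \<Rightarrow> real) \<Rightarrow> real) \<Rightarrow> (nat \<Rightarrow> nat) \<Rightarrow> (nat \<Rightarrow> (nat \<Rightarrow> real) \<Rightarrow> real)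
     \<Rightarrow> (nat \<Rightarrow> (real \<Rightarrow> real) \<times> 'y::real_normed_vector) \<Rightarrow> bool" where
  "equiv_unit_basis X N d \<nu> e \<longleftrightarrow>
     (\<forall>a. (\<exists>z. fst z \<in> X \<and> series_XY N e a z) \<longleftrightarrow> series_Delta_conv d \<nu> a)"

definition projective_via ::
  "(real \<Rightarrow> real) set \<Rightarrow> ((real \<Rightarrow> real) \<Rightarrow> real) \<Rightarrow> (nat \<Rightarrow> nat) \<Rightarrow> (nat \<Rightarrow> (nat \<Rightarrow> real) \<Rightarrow> real)
     \<Rightarrow> (nat \<Rightarrow> real \<Rightarrow> real) \<Rightarrow> (nat \<Rightarrow> (real \<Rightarrow> real) \<times> 'y::banach) \<Rightarrow> bool" where
  "projective_via X N d \<nu> x e \<longleftrightarrow>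
     is_basis_XY X N e \<and> equiv_unit_basis X N d \<nu> e \<and>
     (\<forall>n. AE t in M01. fst (e n) t = x n t)"

end

theory Submission
  imports Defs "HOL-Library.Function_Algebras" "HOL-Complex_Analysis.Great_Picard"
begin

text \<open>
  If the frame is projective, the coefficient map embeds \<open>X\<close> into \<open>\<Delta>\<close>; it is bounded by the closed graph
  theorem, which enters through Zabreiko's lemma on countably subadditive seminorms. Conversely the
  upper frame inequality and the Hahn-Banach theorem give \<open>N (\<Sum> \<xi>\<^sub>n x\<^sub>n) \<le> B \<parallel>\<xi>\<parallel>\<close>. A gliding hump
  argument in the \<open>\<ell>\<^sup>1\<close>-sum \<open>\<Delta>\<close> then shows that every bounded separated sequence \<open>u\<close> in \<open>X\<close> has signed
  sums of \<open>2 J\<close> distinct terms whose norm grows linearly in \<open>J\<close>.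

  This is impossible in a symmetric space. If the norms of the indicators of \<open>[0, s]\<close> stay away from \<open>0\<close>
  as \<open>s \<rightarrow> 0\<close>, disjoint indicators form a separated sequence whose signed sums are bounded by \<open>1\<close>.
  Otherwise the functions \<open>cos (2 \<pi> n t)\<close> are separated, and by orthogonality and Chebyshev's inequality
  their signed sums of \<open>2 J\<close> terms are small compared with \<open>J\<close> off a set of small measure, hence
  have norm \<open>o(J)\<close>.
\<close>

section \<open>Seminormed spaces\<close>

text \<open>The frame inequality bounds synthesis,
  \<open>\<xi> \<mapsto> \<Sum> \<xi>\<^sub>n x\<^sub>n\<close>. Projectivity adds a bounded right
  inverse of synthesis: the coefficients of \<open>(u, 0)\<close> in the basis \<open>e\<close>.
  Growth of signed sums is what remains of the Schur property of an \<ell>1-sum of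
  finite-dimensional spaces when it is phrased without weak convergence. Two features shape the
  proof. The coefficients of a bounded sequence have a coordinatewise limit along a subsequence, but
  this limit need not come from an element of the space; consecutive terms are therefore subtracted,
  and \<open>J\<close> differences use \<open>2 * J\<close> terms. Moreover the frame controls only
  the component in \<open>X\<close> of a basis expansion, while coefficients are controlled by the
  norm of \<open>X \<times> Y\<close>; the growth argument therefore carries two seminorms. Elements
  of \<open>X\<close> are representatives, so \<open>N\<close> is a seminorm on a carrier set.
  Pointwise operations make functions, coordinate sequences and pairs real vector spaces, and one
  locale of seminormed subspaces serves them all.\<close>

instantiation "fun" :: (type, real_vector) real_vector
begin

definition scaleR_fun :: "real \<Rightarrow> ('a \<Rightarrow> 'b) \<Rightarrow> 'a \<Rightarrow> 'b" where
  "scaleR_fun c f = (\<lambda>x. c *\<^sub>R f x)"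

instance
  by standard (simp_all add: scaleR_fun_def fun_eq_iff algebra_simps)

end

lemma scaleR_fun_apply [simp]: "(c *\<^sub>R f) x = c *\<^sub>R f x"
  by (simp add: scaleR_fun_def)

lemma sum_fun_apply: "(\<Sum>i\<in>A. f i) x = (\<Sum>i\<in>A. f i x)"
  by (induction A rule: infinite_finite_induct) auto

locale seminormed_subspace =
  fixes V :: "'a::real_vector set" and q :: "'a \<Rightarrow> real"
  assumes subspace: "subspace V"
    and q_add: "\<lbrakk>x \<in> V; y \<in> V\<rbrakk> \<Longrightarrow> q (x + y) \<le> q x + q y"
    and q_scale: "x \<in> V \<Longrightarrow> q (c *\<^sub>R x) = \<bar>c\<bar> * q x"
begin

lemma V_closed [simp, intro]:
  "0 \<in> V"
  "\<lbrakk>x \<in> V; y \<in> V\<rbrakk> \<Longrightarrow> x + y \<in> V"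
  "\<lbrakk>x \<in> V; y \<in> V\<rbrakk> \<Longrightarrow> x - y \<in> V"
  "x \<in> V \<Longrightarrow> - x \<in> V"
  "x \<in> V \<Longrightarrow> c *\<^sub>R x \<in> V"
  using subspace by (auto simp: subspace_0 subspace_add subspace_diff subspace_neg subspace_scale)

lemma V_sum [intro]: "(\<And>i. i \<in> A \<Longrightarrow> f i \<in> V) \<Longrightarrow> sum f A \<in> V"
  using subspace by (rule subspace_sum)

lemma q_0 [simp]: "q 0 = 0"
  using q_scale [of 0 0] by simp

lemma q_minus [simp]: "x \<in> V \<Longrightarrow> q (- x) = q x"
  using q_scale [of x "-1"] by simp

lemma q_diff: "\<lbrakk>x \<in> V; y \<in> V\<rbrakk> \<Longrightarrow> q (x - y) \<le> q x + q y"
  using q_add [of x "- y"] by simp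

lemma q_nonneg: "x \<in> V \<Longrightarrow> 0 \<le> q x"
  using q_diff [of x x] by simp

lemma q_diff_commute: "\<lbrakk>x \<in> V; y \<in> V\<rbrakk> \<Longrightarrow> q (x - y) = q (y - x)"
  using q_minus [of "x - y"] by simp

lemma q_diff_triangle: "\<lbrakk>x \<in> V; y \<in> V; z \<in> V\<rbrakk> \<Longrightarrow> q (x - z) \<le> q (x - y) + q (y - z)"
  using q_add [of "x - y" "y - z"] by simp

lemma q_sum: "(\<And>i. i \<in> A \<Longrightarrow> f i \<in> V) \<Longrightarrow> q (sum f A) \<le> (\<Sum>i\<in>A. q (f i))"
proof (induction A rule: infinite_finite_induct)
  case (insert a A)
  have "q (f a + sum f A) \<le> q (f a) + q (sum f A)"
    using insert.prems by (intro q_add V_sum) auto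
  also have "\<dots> \<le> q (f a) + (\<Sum>i\<in>A. q (f i))"
    using insert by auto
  finally show ?case using insert by simp
qed auto

lemma q_limit_le:
  assumes "x \<in> V" "\<And>n. s n \<in> V" "(\<lambda>n. q (s n - x)) \<longlonglongrightarrow> 0" "\<And>n. n \<ge> K \<Longrightarrow> q (s n) \<le> C"
  shows "q x \<le> C"
proof (rule field_le_epsilon)
  fix e :: real assume "e > 0"
  with assms(3) obtain n where n: "n \<ge> K" "q (s n - x) < e"
    using eventually_conj [OF order_tendstoD(2) [OF assms(3) \<open>e > 0\<close>] eventually_ge_at_top [of K]]
    by (auto simp: eventually_sequentially)
  have "q x \<le> q (s n) + q (s n - x)"
    using q_diff [of "s n" "s n - x"] assms by auto
  with n assms(4) [of n] show "q x \<le> C + e" by auto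
qed

end

section \<open>Baire category and Zabreiko's lemma\<close>

locale complete_seminormed_subspace = seminormed_subspace +
  assumes complete: "\<lbrakk>\<And>n. s n \<in> V; \<forall>\<epsilon>>0. \<exists>K. \<forall>m\<ge>K. \<forall>n\<ge>K. q (s m - s n) < \<epsilon>\<rbrakk>
     \<Longrightarrow> \<exists>l\<in>V. (\<lambda>n. q (s n - l)) \<longlonglongrightarrow> 0"
begin

text \<open>Baire's argument for the sets \<open>p \<le> n\<close>. If none of them were dense in a
  ball, shrinking closed balls could avoid them one after another, and the limit of the centres
  would have \<open>p\<close> above every \<open>n\<close>.\<close>

lemma zabreiko_somewhere_dense:
  fixes p :: "'a \<Rightarrow> real"
  obtains n :: nat and x r where "x \<in> V" "0 < r"
    "\<forall>y\<in>V. \<forall>\<epsilon>>0. q (y - x) < r \<longrightarrow> (\<exists>a\<in>V. p a \<le> real n \<and> q (y - a) < \<epsilon>)"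
proof (rule ccontr)
  note Pick = that
  assume "\<not> thesis"
  then have far: "\<exists>y\<in>V. q (y - x) < r \<and> (\<exists>\<epsilon>>0. \<forall>a\<in>V. p a \<le> real n \<longrightarrow> \<epsilon> \<le> q (y - a))"
    if "x \<in> V" "0 < r" for x r and n :: nat
    using Pick [OF that, of n] by (meson not_le_imp_less)
  \<comment> \<open>Stage \<open>n\<close> is a closed ball of radius at most
    \<open>(1/2) ^ n\<close>; the next ball lies inside it and misses the set
    \<open>p \<le> n\<close>.\<close>
  define P where "P = (\<lambda>n (x, r). x \<in> V \<and> 0 < r \<and> r \<le> (1/2::real) ^ n)"
  define Q where "Q = (\<lambda>n (x, r) (x', r'). \<forall>z\<in>V. q (z - x') \<le> r' \<longrightarrow> q (z - x) \<le> (r::real) \<and> p z > real n)"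
  have "\<exists>f. \<forall>n. P n (f n) \<and> Q n (f n) (f (Suc n))"
  proof (rule dependent_nat_choice)
    show "\<exists>x. P 0 x"
      unfolding P_def by (rule exI [of _ "(0, 1)"]) auto
    fix xr n assume "P n xr"
    then obtain x r where xr: "xr = (x, r)" "x \<in> V" "0 < r" "r \<le> (1/2) ^ n"
      by (auto simp: P_def)
    obtain y \<epsilon> where y: "y \<in> V" "q (y - x) < r" "0 < \<epsilon>"
      and e: "\<And>a. \<lbrakk>a \<in> V; p a \<le> real n\<rbrakk> \<Longrightarrow> \<epsilon> \<le> q (y - a)"
      using far [OF xr(2,3)] by blast
    \<comment> \<open>The three terms keep the new closed ball inside the old one, off the set
      \<open>p \<le> n\<close>, and on the geometric scale that makes the centres Cauchy.\<close>
    define r' where "r' = min (min (r - q (y - x)) (\<epsilon> / 2)) ((1/2) ^ Suc n)"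
    have "P (Suc n) (y, r')"
      using y unfolding P_def r'_def by (simp del: power_Suc)
    moreover have "Q n xr (y, r')"
      unfolding Q_def xr(1) prod.case
    proof (intro ballI impI conjI)
      fix z assume z: "z \<in> V" "q (z - y) \<le> r'"
      show "q (z - x) \<le> r"
        using q_diff_triangle [of z y x] z y xr by (auto simp: r'_def)
      show "p z > real n"
      proof (rule ccontr)
        assume "\<not> ?thesis"
        then have "\<epsilon> \<le> q (y - z)" using e z by auto
        then show False using z y q_diff_commute [of y z] by (auto simp: r'_def)
      qed
    qed
    ultimately show "\<exists>y. P (Suc n) y \<and> Q n xr y" by blast
  qed
  then obtain f where f: "\<And>n. P n (f n)" "\<And>n. Q n (f n) (f (Suc n))" by blast
  define s where "s n = fst (f n)" for n
  define r where "r n = snd (f n)" for n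
  have s: "s n \<in> V" "0 < r n" "r n \<le> (1/2) ^ n" for n
    using f(1) [of n] by (auto simp: P_def s_def r_def split: prod.splits)
  have nest: "q (z - s n) \<le> r n" "p z > real n" if "z \<in> V" "q (z - s (Suc n)) \<le> r (Suc n)" for z n
    using f(2) [of n] that by (auto simp: Q_def s_def r_def split: prod.splits)
  have nest': "q (z - s n) \<le> r n" if "z \<in> V" "q (z - s m) \<le> r m" "n \<le> m" for z m n
    using that(3)
  proof (induction rule: inc_induct)
    case base
    show ?case by (rule that(2))
  next
    case (step k)
    show ?case by (rule nest(1) [OF that(1) step.IH])
  qed
  have close: "q (s m - s n) \<le> r n" if "n \<le> m" for m n
    by (rule nest' [OF s(1) _ that]) (simp add: s(2) less_imp_le)
  have "\<exists>l\<in>V. (\<lambda>n. q (s n - l)) \<longlonglongrightarrow> 0"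
  proof (rule complete)
    show "\<forall>\<epsilon>>0. \<exists>K. \<forall>m\<ge>K. \<forall>n\<ge>K. q (s m - s n) < \<epsilon>"
    proof (intro allI impI)
      fix \<epsilon> :: real assume "\<epsilon> > 0"
      then obtain K where K: "(1/2::real) ^ K < \<epsilon> / 2"
        using real_arch_pow_inv [of "\<epsilon>/2" "1/2"] by auto
      have "q (s m - s n) < \<epsilon>" if "m \<ge> K" "n \<ge> K" for m n
        using close [OF that(1)] close [OF that(2)] q_diff_triangle [of "s m" "s K" "s n"]
          q_diff_commute [of "s K" "s n"] s K by (smt (verit) field_sum_of_halves)
      then show "\<exists>K. \<forall>m\<ge>K. \<forall>n\<ge>K. q (s m - s n) < \<epsilon>" by blast
    qed
  qed (rule s)
  then obtain l where l: "l \<in> V" "(\<lambda>n. q (s n - l)) \<longlonglongrightarrow> 0" by blast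
  have "q (l - s n) \<le> r n" for n
  proof (rule q_limit_le)
    show "(\<lambda>m. q ((s m - s n) - (l - s n))) \<longlonglongrightarrow> 0" using l by simp
    show "q (s m - s n) \<le> r n" if "m \<ge> n" for m using close that by auto
  qed (use s l in auto)
  then have "p l > real n" for n
    using nest(2) l by blast
  then show False
    by (meson less_asym reals_Archimedean2)
qed

text \<open>The iteration of the open mapping theorem: each vector is approximated with half the
  error at half the cost in \<open>p\<close>, and \<open>p_series\<close>, countable subadditivity,
  adds up the costs. It is applied to \<open>max_psum\<close> and to the norm of \<Delta> pulled
  back along \<open>coef\<close>.\<close>

theorem zabreiko:
  fixes p :: "'a \<Rightarrow> real"
  assumes p_add: "\<And>x y. \<lbrakk>x \<in> V; y \<in> V\<rbrakk> \<Longrightarrow> p (x + y) \<le> p x + p y"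
    and p_scale: "\<And>x c. x \<in> V \<Longrightarrow> p (c *\<^sub>R x) = \<bar>c\<bar> * p x"
    and p_series: "\<And>x s. \<lbrakk>x \<in> V; \<And>n. s n \<in> V; (\<lambda>n. q (x - (\<Sum>k<n. s k))) \<longlonglongrightarrow> 0; summable (\<lambda>n. p (s n))\<rbrakk>
        \<Longrightarrow> p x \<le> (\<Sum>n. p (s n))"
  shows "\<exists>C\<ge>0. \<forall>x\<in>V. p x \<le> C * q x"
proof -
  have p_nonneg: "0 \<le> p x" if "x \<in> V" for x
    using p_add [of x "(-1) *\<^sub>R x"] p_scale [of x "-1"] p_scale [of x 0] that by simp
  obtain n :: nat and x0 r where x0: "x0 \<in> V" and r: "0 < r"
    and dense: "\<And>y \<epsilon>. \<lbrakk>y \<in> V; q (y - x0) < r; 0 < \<epsilon>\<rbrakk> \<Longrightarrow> \<exists>a\<in>V. p a \<le> real n \<and> q (y - a) < \<epsilon>"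
    by (rule zabreiko_somewhere_dense [of p]) (rule that; blast)
  \<comment> \<open>\<open>y\<close> is half the difference of \<open>x0 + y\<close> and
    \<open>x0 - y\<close>, both in the ball about \<open>x0\<close>, so the ball can be recentred at
    0 with the same level \<open>n\<close>.\<close>
  have dense0: "\<exists>a\<in>V. p a \<le> real n \<and> q (y - a) < \<epsilon>" if y: "y \<in> V" "q y < r" "0 < \<epsilon>" for y \<epsilon>
  proof -
    obtain a where a: "a \<in> V" "p a \<le> real n" "q (x0 + y - a) < \<epsilon>"
      using dense [of "x0 + y" \<epsilon>] y x0 by auto
    obtain b where b: "b \<in> V" "p b \<le> real n" "q (x0 - y - b) < \<epsilon>"
      using dense [of "x0 - y" \<epsilon>] y x0 by auto
    let ?a = "(1/2) *\<^sub>R (a + (-1) *\<^sub>R b)"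
    have "p ?a = (1/2) * p (a + (-1) *\<^sub>R b)"
      by (subst p_scale) (use a b in auto)
    also have "\<dots> \<le> (1/2) * (p a + p ((-1) *\<^sub>R b))"
      using p_add [of a "(-1) *\<^sub>R b"] a b by auto
    also have "\<dots> \<le> real n"
      using p_scale [of b "-1"] a b by auto
    finally have 1: "p ?a \<le> real n" .
    have "y - ?a = (1/2) *\<^sub>R ((x0 + y - a) - (x0 - y - b))"
      by (simp add: algebra_simps flip: scaleR_add_left)
    then have "q (y - ?a) = (1/2) * q ((x0 + y - a) - (x0 - y - b))"
      using q_scale [of "(x0 + y - a) - (x0 - y - b)" "1/2"] x0 y a b by auto
    also have "\<dots> < \<epsilon>"
      using q_diff [of "x0 + y - a" "x0 - y - b"] a b x0 y by auto
    finally show ?thesis using 1 a b by (intro bexI [of _ ?a]) auto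
  qed
  have halve: "\<exists>a\<in>V. p a \<le> t * real n \<and> q (y - a) < t / 2 * r" if y: "y \<in> V" "q y < t * r" "0 < t" for y t
  proof -
    have "q ((1/t) *\<^sub>R y) < r"
      using y by (simp add: q_scale field_simps)
    then obtain a where a: "a \<in> V" "p a \<le> real n" "q ((1/t) *\<^sub>R y - a) < r / 2"
      using dense0 [of "(1/t) *\<^sub>R y" "r/2"] y r by auto
    have "y - t *\<^sub>R a = t *\<^sub>R ((1/t) *\<^sub>R y - a)"
      using y by (simp add: algebra_simps)
    then have "q (y - t *\<^sub>R a) = t * q ((1/t) *\<^sub>R y - a)"
      using q_scale [of "(1/t) *\<^sub>R y - a" t] y a by auto
    also have "\<dots> < t / 2 * r" using a y by (simp add: field_simps)
    finally show ?thesis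
      using a y p_scale [of a t] by (intro bexI [of _ "t *\<^sub>R a"]) auto
  qed
  \<comment> \<open>The remainders \<open>f k\<close> start at \<open>y\<close> and shrink like
    \<open>(1/2) ^ k\<close>; the costs of their successive differences sum to at most
    \<open>2 * n\<close>.\<close>
  have ball: "p y \<le> 2 * real n" if y: "y \<in> V" "q y < r" for y
  proof -
    define P where "P = (\<lambda>k z. z \<in> V \<and> q z < (1/2) ^ k * r)"
    define Q where "Q = (\<lambda>k z z'. p (z - z') \<le> (1/2) ^ k * real n)"
    have "\<exists>f. \<forall>k. (P k (f k) \<and> (k = 0 \<longrightarrow> f k = y)) \<and> Q k (f k) (f (Suc k))"
    proof (rule dependent_nat_choice)
      show "\<exists>x. P 0 x \<and> (0 = (0::nat) \<longrightarrow> x = y)"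
        using y by (auto simp: P_def)
      fix z k assume "P k z \<and> (k = 0 \<longrightarrow> z = y)"
      then have z: "z \<in> V" "q z < (1/2) ^ k * r" by (auto simp: P_def)
      then obtain a where "a \<in> V" "p a \<le> (1/2) ^ k * real n" "q (z - a) < (1/2) ^ k / 2 * r"
        using halve [of z "(1/2) ^ k"] by auto
      then show "\<exists>z'. (P (Suc k) z' \<and> (Suc k = 0 \<longrightarrow> z' = y)) \<and> Q k z z'"
        using z by (intro exI [of _ "z - a"]) (auto simp: P_def Q_def)
    qed
    then obtain f where f: "\<And>k. f k \<in> V" "\<And>k. q (f k) < (1/2) ^ k * r" "f 0 = y"
      "\<And>k. p (f k - f (Suc k)) \<le> (1/2) ^ k * real n"
      unfolding P_def Q_def by blast
    have tele: "(\<Sum>k<m. f k - f (Suc k)) = y - f m" for m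
      using sum_lessThan_telescope' [of f m] f(3) by simp
    have gs: "summable (\<lambda>k. (1/2::real) ^ k * real n)" "(\<Sum>k. (1/2::real) ^ k * real n) = 2 * real n"
      using sums_mult2 [OF geometric_sums [of "1/2::real"], of "real n"] by (auto simp: sums_iff)
    have "(\<lambda>k. q (f k)) \<longlonglongrightarrow> 0"
    proof (rule tendsto_sandwich [OF _ _ tendsto_const])
      show "(\<lambda>k. (1/2) ^ k * r) \<longlonglongrightarrow> 0"
        by (intro tendsto_mult_left_zero LIMSEQ_realpow_zero) auto
    qed (use f(1,2) q_nonneg in \<open>auto intro!: always_eventually simp: less_imp_le\<close>)
    moreover have sp: "summable (\<lambda>k. p (f k - f (Suc k)))"
      by (rule summable_comparison_test' [OF gs(1), of 0]) (use f p_nonneg in auto)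
    ultimately have "p y \<le> (\<Sum>k. p (f k - f (Suc k)))"
      using y f(1) by (intro p_series) (auto simp: tele)
    also have "\<dots> \<le> (\<Sum>k. (1/2) ^ k * real n)"
      by (intro suminf_le sp gs f)
    finally show ?thesis using gs by simp
  qed
  have "p x \<le> 2 * real n / r * q x" if x: "x \<in> V" for x
  proof (rule dense_ge)
    \<comment> \<open>Since \<open>q x\<close> may be 0, \<open>x\<close> is scaled by
      \<open>r / s\<close> for arbitrary \<open>s > q x\<close>.\<close>
    have le: "p x \<le> 2 * real n / r * s" if "q x < s" for s
    proof -
      have s: "s > 0" using that q_nonneg [OF x] by linarith
      have "q ((r / s) *\<^sub>R x) < r"
        using that s r x by (simp add: q_scale field_simps)
      then have "p ((r / s) *\<^sub>R x) \<le> 2 * real n" using ball x by auto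
      then show ?thesis using s r x by (simp add: p_scale field_simps)
    qed
    fix c assume c: "2 * real n / r * q x < c"
    show "p x \<le> c"
    \<comment> \<open>The choice of \<open>s\<close> in the other case divides by \<open>n\<close>.
      For \<open>n = 0\<close> any \<open>s\<close> already gives
      \<open>p x \<le> 0\<close>.\<close>
    proof (cases "n = 0")
      case True
      then show ?thesis using le [of "q x + 1"] c by simp
    next
      case False
      then show ?thesis using le [of "c * r / (2 * real n)"] c r by (simp add: field_simps)
    qed
  qed
  then show ?thesis using r by (intro exI [of _ "2 * real n / r"]) auto
qed

end

section \<open>The Hahn-Banach theorem from minimal sublinear functionals\<close>

context seminormed_subspace
begin

text \<open>Prescribing the value 0 outside \<open>V\<close> makes the pointwise order on all
  functions agree with comparison on \<open>V\<close>, so that Zorn's lemma yields equality of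
  functions.\<close>

definition dominated_sublinear :: "('a \<Rightarrow> real) set" where
  "dominated_sublinear = {p. (\<forall>x. x \<notin> V \<longrightarrow> p x = 0) \<and>
     (\<forall>x\<in>V. \<forall>y\<in>V. p (x + y) \<le> p x + p y) \<and>
     (\<forall>x\<in>V. \<forall>c\<ge>0. p (c *\<^sub>R x) = c * p x) \<and> (\<forall>x\<in>V. p x \<le> q x)}"

lemma dominated_sublinearD:
  assumes "p \<in> dominated_sublinear"
  shows "x \<notin> V \<Longrightarrow> p x = 0"
    "\<lbrakk>x \<in> V; y \<in> V\<rbrakk> \<Longrightarrow> p (x + y) \<le> p x + p y"
    "\<lbrakk>x \<in> V; c \<ge> 0\<rbrakk> \<Longrightarrow> p (c *\<^sub>R x) = c * p x"
    "x \<in> V \<Longrightarrow> p x \<le> q x"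
    "x \<in> V \<Longrightarrow> - q x \<le> p x"
proof -
  show add: "p (x + y) \<le> p x + p y" if "x \<in> V" "y \<in> V" for x y
    using assms that by (auto simp: dominated_sublinear_def)
  show "x \<notin> V \<Longrightarrow> p x = 0" "\<lbrakk>x \<in> V; c \<ge> 0\<rbrakk> \<Longrightarrow> p (c *\<^sub>R x) = c * p x"
    using assms by (auto simp: dominated_sublinear_def)
  show le: "p x \<le> q x" if "x \<in> V" for x
    using assms that by (auto simp: dominated_sublinear_def)
  show "- q x \<le> p x" if "x \<in> V"
  proof -
    have "p (0 *\<^sub>R x) = 0 * p x"
      using assms that unfolding dominated_sublinear_def by blast
    then have "0 = p (x + - x)" by simp
    also have "\<dots> \<le> p x + p (- x)" using that by (intro add) auto
    also have "p (- x) \<le> q x" using le [of "- x"] that by auto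
    finally show ?thesis by simp
  qed
qed

text \<open>If \<open>p\<close> is minimal, then \<open>lower_along p y = p\<close>, and the term \<open>t = 1\<close> of the infimum yields
  \<open>p x + p y \<le> p (x + y)\<close>: minimal sublinear functionals are linear.\<close>

definition lower_along :: "('a \<Rightarrow> real) \<Rightarrow> 'a \<Rightarrow> 'a \<Rightarrow> real" where
  "lower_along p y x = (if x \<in> V then INF t\<in>{0..}. p (x + t *\<^sub>R y) - t * p y else 0)"

lemma lower_along_le:
  assumes p: "p \<in> dominated_sublinear" and "x \<in> V" "y \<in> V" "t \<ge> 0"
  shows "lower_along p y x \<le> p (x + t *\<^sub>R y) - t * p y"
proof -
  have "bdd_below ((\<lambda>t. p (x + t *\<^sub>R y) - t * p y) ` {0..})"
  proof (rule bdd_belowI2)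
    fix t :: real assume "t \<in> {0..}"
    then have "t * p y = p (t *\<^sub>R y)"
      using dominated_sublinearD(3) [OF p] assms by simp
    also have "\<dots> \<le> p (x + t *\<^sub>R y) + p (- x)"
      using dominated_sublinearD(2) [OF p, of "x + t *\<^sub>R y" "- x"] assms by simp
    finally show "- p (- x) \<le> p (x + t *\<^sub>R y) - t * p y" by simp
  qed
  then show ?thesis
    unfolding lower_along_def using assms by (auto intro: cINF_lower)
qed

lemma lower_along_greatest:
  assumes "x \<in> V" "\<And>t. t \<ge> 0 \<Longrightarrow> b \<le> p (x + t *\<^sub>R y) - t * p y"
  shows "b \<le> lower_along p y x"
  unfolding lower_along_def using assms by (auto intro!: cINF_greatest)

text \<open>Subadditivity survives the infimum because the shifts \<open>s\<close> and
  \<open>t\<close> of two vectors add up to an admissible shift of their sum. The third conclusion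
  is the term \<open>t = 1\<close>; it provides the starting point of the Zorn argument.\<close>

lemma lower_along_dominated_sublinear:
  assumes p: "p \<in> dominated_sublinear" and y: "y \<in> V"
  shows "lower_along p y \<in> dominated_sublinear"
    and "lower_along p y \<le> p"
    and "lower_along p y (- y) \<le> - p y"
proof -
  note D = dominated_sublinearD [OF p]
  have p0: "p 0 = 0" using D(3) [of 0 0] by simp
  have le: "lower_along p y x \<le> p x" for x
  proof (cases "x \<in> V")
    case True
    then show ?thesis using lower_along_le [OF p True y, of 0] by simp
  qed (simp add: lower_along_def D)
  then show "lower_along p y \<le> p" by (simp add: le_fun_def)
  show "lower_along p y (- y) \<le> - p y"
    using lower_along_le [OF p, of "- y" y 1] y p0 by simp
  have add: "lower_along p y (x + x') \<le> lower_along p y x + lower_along p y x'" if x: "x \<in> V" "x' \<in> V" for x x'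
  proof -
    have *: "lower_along p y (x + x') \<le> (p (x + s *\<^sub>R y) - s * p y) + (p (x' + t *\<^sub>R y) - t * p y)"
      if "s \<ge> 0" "t \<ge> 0" for s t
    proof -
      have "lower_along p y (x + x') \<le> p (x + x' + (s + t) *\<^sub>R y) - (s + t) * p y"
        using x y that by (intro lower_along_le [OF p]) auto
      moreover have "p ((x + s *\<^sub>R y) + (x' + t *\<^sub>R y)) \<le> p (x + s *\<^sub>R y) + p (x' + t *\<^sub>R y)"
        using x y by (intro D(2)) auto
      ultimately show ?thesis by (simp add: algebra_simps)
    qed
    have "lower_along p y (x + x') - (p (x + s *\<^sub>R y) - s * p y) \<le> lower_along p y x'" if "s \<ge> 0" for s
      using * [OF that] x by (intro lower_along_greatest) (auto simp: algebra_simps)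
    then have "lower_along p y (x + x') - lower_along p y x' \<le> lower_along p y x"
      using x by (intro lower_along_greatest) (auto simp: algebra_simps)
    then show ?thesis by simp
  qed
  have scale_le: "lower_along p y (c *\<^sub>R x) \<le> c * lower_along p y x" if x: "x \<in> V" and c: "c > 0" for x c
  proof -
    have "lower_along p y (c *\<^sub>R x) / c \<le> lower_along p y x"
    proof (rule lower_along_greatest [OF x])
      fix t :: real assume t: "t \<ge> 0"
      have "lower_along p y (c *\<^sub>R x) \<le> p (c *\<^sub>R x + (c * t) *\<^sub>R y) - (c * t) * p y"
        using x y c t by (intro lower_along_le [OF p]) auto
      also have "c *\<^sub>R x + (c * t) *\<^sub>R y = c *\<^sub>R (x + t *\<^sub>R y)"
        by (simp add: algebra_simps)
      also have "p \<dots> = c * p (x + t *\<^sub>R y)"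
        using x y c by (intro D(3)) auto
      finally show "lower_along p y (c *\<^sub>R x) / c \<le> p (x + t *\<^sub>R y) - t * p y"
        using c by (simp add: field_simps)
    qed
    then show ?thesis using c by (simp add: field_simps)
  qed
  have zero: "lower_along p y 0 = 0"
  proof (rule antisym)
    show "lower_along p y 0 \<le> 0" using le [of 0] p0 by simp
    show "0 \<le> lower_along p y 0" using y D(3) by (intro lower_along_greatest) auto
  qed
  have scale: "lower_along p y (c *\<^sub>R x) = c * lower_along p y x" if x: "x \<in> V" and c: "c \<ge> 0" for x c
  proof (cases "c = 0")
    case False
    with c have c: "c > 0" by simp
    have "lower_along p y ((1/c) *\<^sub>R (c *\<^sub>R x)) \<le> (1/c) * lower_along p y (c *\<^sub>R x)"
      using x c by (intro scale_le) auto
    then have "c * lower_along p y x \<le> lower_along p y (c *\<^sub>R x)"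
      using c by (simp add: field_simps)
    then show ?thesis using scale_le [OF x c] by simp
  qed (simp add: zero)
  have "lower_along p y x \<le> q x" if "x \<in> V" for x
    using le [of x] D(4) [OF that] by simp
  then show "lower_along p y \<in> dominated_sublinear"
    unfolding dominated_sublinear_def using add scale by (auto simp: lower_along_def)
qed

text \<open>The constraint \<open>p (- z) \<le> - q z\<close> passes to infima of chains, and for a
  linear \<open>p\<close> it says \<open>q z \<le> p z\<close>. Minimality among the constrained
  functionals is enough for linearity, since \<open>lower_along m y\<close> lies below
  \<open>m\<close> and so inherits the constraint.\<close>

theorem norming_functional_exists:
  assumes z: "z \<in> V"
  obtains f :: "'a \<Rightarrow> real" where "\<And>x y. \<lbrakk>x \<in> V; y \<in> V\<rbrakk> \<Longrightarrow> f (x + y) = f x + f y"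
    "\<And>x c. x \<in> V \<Longrightarrow> f (c *\<^sub>R x) = c * f x" "\<And>x. x \<in> V \<Longrightarrow> \<bar>f x\<bar> \<le> q x" "f z = q z"
proof -
  define S where "S = {p \<in> dominated_sublinear. p (- z) \<le> - q z}"
  define q0 where "q0 x = (if x \<in> V then q x else 0)" for x
  have q0: "q0 \<in> dominated_sublinear"
    using q_add q_scale by (auto simp: dominated_sublinear_def q0_def)
  have start: "lower_along q0 z \<in> S"
    using lower_along_dominated_sublinear [OF q0 z] z by (simp add: S_def q0_def)
  have "\<exists>m\<in>S. \<forall>a\<in>S. a \<le> m \<longrightarrow> a = m"
  proof (rule predicate_Zorn)
    show "partial_order_on S (relation_of (\<lambda>a b. b \<le> a) S)"
      by (rule partial_order_on_relation_ofI) auto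
    fix C assume C: "C \<in> Chains (relation_of (\<lambda>a b. b \<le> a) S)"
    then have CS: "C \<subseteq> S" and total: "\<And>a b. \<lbrakk>a \<in> C; b \<in> C\<rbrakk> \<Longrightarrow> a \<le> b \<or> b \<le> a"
      by (auto simp: Chains_def relation_of_def)
    show "\<exists>u\<in>S. \<forall>a\<in>C. u \<le> a"
    proof (cases "C = {}")
      case False
      define u where "u x = (INF p\<in>C. p x)" for x
      have ds: "p \<in> dominated_sublinear" "p (- z) \<le> - q z" if "p \<in> C" for p
        using CS that by (auto simp: S_def)
      have lower: "u x \<le> p x" if "p \<in> C" for p x
      proof -
        have "bdd_below ((\<lambda>p. p x) ` C)"
        proof (rule bdd_belowI2)
          show "- \<bar>q x\<bar> \<le> p x" if "p \<in> C" for p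
            using dominated_sublinearD [OF ds(1) [OF that], of x] by (cases "x \<in> V") auto
        qed
        then show ?thesis unfolding u_def by (rule cINF_lower) (rule that)
      qed
      have greatest: "b \<le> u x" if "\<And>p. p \<in> C \<Longrightarrow> b \<le> p x" for b x
        unfolding u_def using False that by (rule cINF_greatest)
      obtain p0 where p0: "p0 \<in> C" using False by blast
      have vanish: "u x = 0" if "\<And>p. p \<in> C \<Longrightarrow> p x = 0" for x
        using lower [OF p0, of x] greatest [of 0 x] that p0 by force
      have add: "u (x + y) \<le> u x + u y" if xy: "x \<in> V" "y \<in> V" for x y
      proof -
        have "u (x + y) \<le> p x + p' y" if pp: "p \<in> C" "p' \<in> C" for p p'
        proof -
          \<comment> \<open>Two different members of the chain bound the two summands; the smaller
            one serves for both and is itself subadditive.\<close>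
          obtain r where "r \<in> C" "r \<le> p" "r \<le> p'" using total [OF pp] pp order_refl by metis
          then have "u (x + y) \<le> r x + r y" "r x \<le> p x" "r y \<le> p' y"
            using lower [of r "x + y"] dominated_sublinearD(2) [OF ds(1), of r x y] xy
            by (auto simp: le_fun_def)
          then show ?thesis by linarith
        qed
        then have "u (x + y) - p x \<le> u y" if "p \<in> C" for p
          using that by (intro greatest) (metis add.commute diff_le_eq)
        then have "u (x + y) - u y \<le> u x"
          by (intro greatest) (metis add.commute diff_le_eq)
        then show ?thesis by simp
      qed
      have scale_le: "c * u x \<le> u (c *\<^sub>R x)" if "x \<in> V" "c \<ge> 0" for x c
      proof (rule greatest)
        fix p assume p: "p \<in> C"
        have "c * u x \<le> c * p x" using lower [OF p] that by (intro mult_left_mono)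
        also have "\<dots> = p (c *\<^sub>R x)" using dominated_sublinearD(3) [OF ds(1) [OF p]] that by simp
        finally show "c * u x \<le> p (c *\<^sub>R x)" .
      qed
      have scale: "u (c *\<^sub>R x) = c * u x" if x: "x \<in> V" and c: "c \<ge> 0" for x c
      proof (cases "c = 0")
        case True
        have "p 0 = 0" if "p \<in> C" for p
          using dominated_sublinearD(3) [OF ds(1) [OF that], of 0 0] by simp
        then show ?thesis using True vanish [of 0] by simp
      next
        case nz: False
        have "(1/c) * u (c *\<^sub>R x) \<le> u ((1/c) *\<^sub>R (c *\<^sub>R x))"
          using x c by (intro scale_le) auto
        then have "u (c *\<^sub>R x) \<le> c * u x" using nz c by (simp add: field_simps)
        then show ?thesis using scale_le [OF x c] by simp
      qed
      have "u x = 0" if "x \<notin> V" for x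
        using vanish dominated_sublinearD(1) [OF ds(1) that] by blast
      moreover have "u x \<le> q x" if "x \<in> V" for x
        using lower [OF p0, of x] dominated_sublinearD(4) [OF ds(1) [OF p0] that] by simp
      moreover have "u (- z) \<le> - q z"
        using lower [OF p0, of "- z"] ds(2) [OF p0] by simp
      ultimately have "u \<in> S"
        unfolding S_def dominated_sublinear_def using add scale by auto
      then show ?thesis using lower by (intro bexI [of _ u]) (auto simp: le_fun_def)
    qed (use start in auto)
  qed
  then obtain m where m: "m \<in> S" and min: "\<And>a. \<lbrakk>a \<in> S; a \<le> m\<rbrakk> \<Longrightarrow> a = m" by blast
  have ds: "m \<in> dominated_sublinear" and mz: "m (- z) \<le> - q z" using m by (auto simp: S_def)
  note D = dominated_sublinearD [OF ds]
  have add: "m (x + y) = m x + m y" if xy: "x \<in> V" "y \<in> V" for x y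
  proof (rule antisym)
    show "m (x + y) \<le> m x + m y" using D(2) xy .
    have "lower_along m y \<in> S"
      using lower_along_dominated_sublinear(1,2) [OF ds xy(2)] mz
      unfolding S_def by (auto simp: le_fun_def intro: order_trans)
    then have "m = lower_along m y"
      using min lower_along_dominated_sublinear(2) [OF ds xy(2)] by metis
    then have "m x \<le> m (x + 1 *\<^sub>R y) - 1 * m y"
      using lower_along_le [OF ds xy, of 1] by simp
    then show "m x + m y \<le> m (x + y)" by simp
  qed
  have m0: "m 0 = 0" using D(3) [of 0 0] by simp
  have minus: "m (- x) = - m x" if "x \<in> V" for x
    using add [of x "- x"] that m0 by simp
  show thesis
  proof (rule that [OF add])
    show "m (c *\<^sub>R x) = c * m x" if "x \<in> V" for x c
    proof (cases "c \<ge> 0")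
      case False
      then have "m (- ((- c) *\<^sub>R x)) = - (- c * m x)"
        using minus [of "(- c) *\<^sub>R x"] D(3) [of x "- c"] that by simp
      then show ?thesis by simp
    qed (use D(3) that in auto)
    show "\<bar>m x\<bar> \<le> q x" if "x \<in> V" for x
      using D(4,5) [OF that] by simp
    then show "m z = q z" using mz minus [OF z] z by fastforce
  qed auto
qed

end

section \<open>Schauder bases\<close>

locale schauder_basis = complete_seminormed_subspace V q for V :: "'a::real_vector set" and q +
  fixes e :: "nat \<Rightarrow> 'a"
  assumes e_in [simp, intro]: "e n \<in> V"
    and expansion: "z \<in> V \<Longrightarrow> \<exists>!a. (\<lambda>m. q (z - (\<Sum>n<m. a n *\<^sub>R e n))) \<longlonglongrightarrow> 0"
begin

definition coef :: "'a \<Rightarrow> nat \<Rightarrow> real" where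
  "coef z = (THE a. (\<lambda>m. q (z - (\<Sum>n<m. a n *\<^sub>R e n))) \<longlonglongrightarrow> 0)"

definition psum :: "(nat \<Rightarrow> real) \<Rightarrow> nat \<Rightarrow> 'a" where
  "psum a m = (\<Sum>n<m. a n *\<^sub>R e n)"

lemma psum_in [simp, intro]: "psum a m \<in> V"
  by (auto simp: psum_def)

lemma coef_tendsto: "z \<in> V \<Longrightarrow> (\<lambda>m. q (z - psum (coef z) m)) \<longlonglongrightarrow> 0"
  using theI' [OF expansion] by (simp add: coef_def psum_def)

lemma coef_eqI: "\<lbrakk>z \<in> V; (\<lambda>m. q (z - psum a m)) \<longlonglongrightarrow> 0\<rbrakk> \<Longrightarrow> coef z = a"
  using expansion [of z] coef_tendsto [of z] by (auto simp: psum_def)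

lemma psum_add: "psum (a + b) m = psum a m + psum b m"
  by (simp add: psum_def scaleR_add_left sum.distrib)

lemma psum_scale: "psum (c *\<^sub>R a) m = c *\<^sub>R psum a m"
  by (simp add: psum_def scaleR_sum_right)

lemma psum_sum: "psum (\<Sum>i\<in>A. a i) m = (\<Sum>i\<in>A. psum (a i) m)"
  by (simp add: psum_def sum_fun_apply scaleR_sum_left sum.swap [of _ _ A])

lemma coef_add: assumes "x \<in> V" "y \<in> V" shows "coef (x + y) = coef x + coef y"
proof (rule coef_eqI)
  show "(\<lambda>m. q (x + y - psum (coef x + coef y) m)) \<longlonglongrightarrow> 0"
  proof (rule tendsto_sandwich [OF _ _ tendsto_const])
    show "(\<lambda>m. q (x - psum (coef x) m) + q (y - psum (coef y) m)) \<longlonglongrightarrow> 0"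
      using tendsto_add [OF coef_tendsto coef_tendsto] assms by fastforce
    have "q (x + y - psum (coef x + coef y) m) \<le> q (x - psum (coef x) m) + q (y - psum (coef y) m)" for m
      using q_add [of "x - psum (coef x) m" "y - psum (coef y) m"] assms
      by (auto simp: psum_add algebra_simps)
    then show "\<forall>\<^sub>F m in sequentially. q (x + y - psum (coef x + coef y) m)
        \<le> q (x - psum (coef x) m) + q (y - psum (coef y) m)" by simp
  qed (use assms in \<open>auto intro!: always_eventually q_nonneg\<close>)
qed (use assms in auto)

lemma coef_scale: assumes "x \<in> V" shows "coef (c *\<^sub>R x) = c *\<^sub>R coef x"
proof (rule coef_eqI)
  have "q (c *\<^sub>R x - psum (c *\<^sub>R coef x) m) = \<bar>c\<bar> * q (x - psum (coef x) m)" for m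
    using q_scale [of "x - psum (coef x) m" c] assms by (auto simp: psum_scale algebra_simps)
  then show "(\<lambda>m. q (c *\<^sub>R x - psum (c *\<^sub>R coef x) m)) \<longlonglongrightarrow> 0"
    using tendsto_mult_right_zero [OF coef_tendsto] assms by simp
qed (use assms in auto)

lemma coef_diff: "\<lbrakk>x \<in> V; y \<in> V\<rbrakk> \<Longrightarrow> coef (x - y) = coef x - coef y"
  using coef_add [of x "(-1) *\<^sub>R y"] coef_scale [of y "-1"] by simp

lemma coef_0: "coef 0 = 0"
  using coef_scale [of 0 0] by simp

lemma coef_sum: "(\<And>i. i \<in> A \<Longrightarrow> f i \<in> V) \<Longrightarrow> coef (\<Sum>i\<in>A. f i) = (\<Sum>i\<in>A. coef (f i))"
  by (induction A rule: infinite_finite_induct) (auto simp: coef_add coef_0 V_sum)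

text \<open>Positivity is not automatic for a seminorm: a null basis vector would give 0 a second
  expansion.\<close>

lemma q_basis_pos: "0 < q (e n)"
proof (rule ccontr)
  assume "\<not> ?thesis"
  then have q: "q (e n) = 0" using q_nonneg [of "e n"] by simp
  let ?a = "\<lambda>i. if i = n then 1 else 0 :: real"
  have "q (0 - psum ?a m) = 0" for m
  proof -
    have "psum ?a m = (if n < m then e n else 0)"
      by (simp add: psum_def if_distrib [of "\<lambda>c. c *\<^sub>R _"] cong: if_cong)
    then show ?thesis using q by simp
  qed
  then have "coef 0 = ?a" by (intro coef_eqI) auto
  then show False using coef_0 by (auto simp: fun_eq_iff dest: spec [of _ n])
qed

text \<open>The classical renorming under which all partial sum projections become
  contractions.\<close>

definition max_psum :: "'a \<Rightarrow> real" where
  "max_psum z = (SUP m. q (psum (coef z) m))"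

lemma psum_le_max_psum: assumes "z \<in> V" shows "q (psum (coef z) m) \<le> max_psum z"
proof -
  obtain B where B: "\<And>m. \<bar>q (z - psum (coef z) m)\<bar> \<le> B"
    using convergent_imp_Bseq [OF convergentI [OF coef_tendsto [OF assms]]] by (auto simp: Bseq_def)
  have "q (psum (coef z) m) \<le> q z + B" for m
    using q_diff [of z "z - psum (coef z) m"] B [of m] assms by auto
  then have "bdd_above (range (\<lambda>m. q (psum (coef z) m)))"
    by (intro bdd_aboveI2)
  then show ?thesis unfolding max_psum_def by (intro cSUP_upper) auto
qed

lemma max_psum_least: "(\<And>m. q (psum (coef z) m) \<le> C) \<Longrightarrow> max_psum z \<le> C"
  unfolding max_psum_def by (intro cSUP_least) auto

lemma max_psum_nonneg: "z \<in> V \<Longrightarrow> 0 \<le> max_psum z"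
  using psum_le_max_psum [of z 0] by (simp add: psum_def)

lemma max_psum_add: "\<lbrakk>x \<in> V; y \<in> V\<rbrakk> \<Longrightarrow> max_psum (x + y) \<le> max_psum x + max_psum y"
proof (rule max_psum_least)
  fix m assume "x \<in> V" "y \<in> V"
  then show "q (psum (coef (x + y)) m) \<le> max_psum x + max_psum y"
    using q_add [of "psum (coef x) m" "psum (coef y) m"] psum_le_max_psum [of x m] psum_le_max_psum [of y m]
    by (auto simp: coef_add psum_add)
qed

lemma max_psum_scale: assumes "x \<in> V" shows "max_psum (c *\<^sub>R x) = \<bar>c\<bar> * max_psum x"
proof -
  have le: "max_psum (c *\<^sub>R x) \<le> \<bar>c\<bar> * max_psum x" if "x \<in> V" for c x
    using that psum_le_max_psum [of x]
    by (intro max_psum_least) (auto simp: coef_scale psum_scale q_scale intro: mult_left_mono)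
  show ?thesis
  proof (cases "c = 0")
    case True
    then show ?thesis by (simp add: max_psum_def coef_0 psum_def)
  next
    case False
    have "max_psum ((1/c) *\<^sub>R (c *\<^sub>R x)) \<le> \<bar>1/c\<bar> * max_psum (c *\<^sub>R x)"
      using assms by (intro le) auto
    then have "\<bar>c\<bar> * max_psum x \<le> max_psum (c *\<^sub>R x)"
      using False by (simp add: field_simps)
    then show ?thesis using le [OF assms, of c] by simp
  qed
qed

lemma coef_le_max_psum: assumes "z \<in> V" shows "\<bar>coef z n\<bar> \<le> 2 / q (e n) * max_psum z"
proof -
  have "\<bar>coef z n\<bar> * q (e n) = q (psum (coef z) (Suc n) - psum (coef z) n)"
    by (simp add: psum_def q_scale)
  also have "\<dots> \<le> q (psum (coef z) (Suc n)) + q (psum (coef z) n)"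
    by (intro q_diff) auto
  also have "\<dots> \<le> 2 * max_psum z"
    using psum_le_max_psum [OF assms, of "Suc n"] psum_le_max_psum [OF assms, of n] by linarith
  finally show ?thesis using q_basis_pos [of n] by (simp add: field_simps)
qed

text \<open>Countable subadditivity for Zabreiko's lemma. The coefficients of the terms sum to a
  sequence \<open>b\<close>; the tails are small uniformly in the length \<open>m\<close> of the
  partial sums, so \<open>b\<close> expands \<open>x\<close>, and uniqueness identifies it with
  \<open>coef x\<close>.\<close>

lemma max_psum_series:
  assumes x: "x \<in> V" and s: "\<And>n. s n \<in> V"
    and lim: "(\<lambda>n. q (x - (\<Sum>k<n. s k))) \<longlonglongrightarrow> 0" and sm: "summable (\<lambda>n. max_psum (s n))"
  shows "max_psum x \<le> (\<Sum>n. max_psum (s n))"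
proof -
  define b where "b n = (\<Sum>j. coef (s j) n)" for n
  define T where "T J = (\<Sum>j. max_psum (s (j + J)))" for J
  have sc: "summable (\<lambda>j. coef (s j) n)" for n
    by (rule summable_comparison_test' [OF summable_mult [OF sm, of "2 / q (e n)"], of 0])
      (use coef_le_max_psum s in auto)
  have lim_b: "(\<lambda>J. q (psum b m - (\<Sum>j<J. psum (coef (s j)) m))) \<longlonglongrightarrow> 0" for m
  proof (rule tendsto_sandwich [OF _ _ tendsto_const])
    have "(\<lambda>J. \<Sum>n<m. \<bar>b n - (\<Sum>j<J. coef (s j) n)\<bar> * q (e n)) \<longlonglongrightarrow> (\<Sum>n<m. \<bar>b n - b n\<bar> * q (e n))"
      unfolding b_def by (intro tendsto_intros summable_LIMSEQ sc)
    then show "(\<lambda>J. \<Sum>n<m. \<bar>b n - (\<Sum>j<J. coef (s j) n)\<bar> * q (e n)) \<longlonglongrightarrow> 0" by simp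
    have "q (psum b m - (\<Sum>j<J. psum (coef (s j)) m)) \<le> (\<Sum>n<m. \<bar>b n - (\<Sum>j<J. coef (s j) n)\<bar> * q (e n))" for J
    proof -
      have "psum b m - (\<Sum>j<J. psum (coef (s j)) m) = (\<Sum>n<m. (b n - (\<Sum>j<J. coef (s j) n)) *\<^sub>R e n)"
        by (simp add: psum_sum [symmetric]) (simp add: psum_def sum_fun_apply sum_subtractf scaleR_diff_left)
      also have "q \<dots> \<le> (\<Sum>n<m. q ((b n - (\<Sum>j<J. coef (s j) n)) *\<^sub>R e n))"
        by (intro q_sum) auto
      finally show ?thesis by (simp add: q_scale)
    qed
    then show "\<forall>\<^sub>F J in sequentially. q (psum b m - (\<Sum>j<J. psum (coef (s j)) m)) \<le> (\<Sum>n<m. \<bar>b n - (\<Sum>j<J. coef (s j) n)\<bar> * q (e n))"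
      by simp
  qed (auto intro!: always_eventually q_nonneg V_sum)
  \<comment> \<open>The bound is independent of \<open>m\<close>; this is what permits exchanging
    the limits in \<open>m\<close> and \<open>J\<close>.\<close>
  have tail: "q (psum b m - (\<Sum>j<J. psum (coef (s j)) m)) \<le> T J" for m J
  proof (rule q_limit_le)
    let ?t = "\<lambda>J'. \<Sum>j<J'. psum (coef (s (j + J))) m"
    have "?t J' - (psum b m - (\<Sum>j<J. psum (coef (s j)) m)) = - (psum b m - (\<Sum>j<J' + J. psum (coef (s j)) m))" for J'
      by (induction J') (simp_all add: algebra_simps)
    then have "q (?t J' - (psum b m - (\<Sum>j<J. psum (coef (s j)) m))) = q (psum b m - (\<Sum>j<J' + J. psum (coef (s j)) m))" for J'
      by (simp only: q_minus V_closed psum_in V_sum)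
    then show "(\<lambda>J'. q (?t J' - (psum b m - (\<Sum>j<J. psum (coef (s j)) m)))) \<longlonglongrightarrow> 0"
      using LIMSEQ_ignore_initial_segment [OF lim_b, of m J] by simp
    show "q (?t J') \<le> T J" for J'
    proof -
      have "q (?t J') \<le> (\<Sum>j<J'. q (psum (coef (s (j + J))) m))"
        by (intro q_sum) auto
      also have "\<dots> \<le> (\<Sum>j<J'. max_psum (s (j + J)))"
        by (intro sum_mono psum_le_max_psum s)
      also have "\<dots> \<le> T J"
        unfolding T_def using s
          by (intro sum_le_suminf summable_ignore_initial_segment [OF sm]) (auto simp: max_psum_nonneg)
      finally show ?thesis .
    qed
  qed (auto intro!: V_sum)
  have T0: "T \<longlonglongrightarrow> 0"
    unfolding T_def using suminf_exist_split2 [OF sm] .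
  have "coef x = b"
  proof (rule coef_eqI [OF x], rule LIMSEQ_I)
    fix r :: real assume "r > 0"
    \<comment> \<open>First \<open>J\<close> is fixed so that the remainder of the series and the
      tail are small; then \<open>m\<close> is taken large for the finitely many expansions of
      \<open>s j\<close> with \<open>j < J\<close>.\<close>
    then have "\<forall>\<^sub>F J in sequentially. q (x - (\<Sum>k<J. s k)) < r/3 \<and> T J < r/3"
      using order_tendstoD(2) [OF lim, of "r/3"] order_tendstoD(2) [OF T0, of "r/3"]
      by (auto intro: eventually_conj)
    then obtain J where J: "q (x - (\<Sum>k<J. s k)) < r/3" "T J < r/3"
      by (auto simp: eventually_sequentially)
    have "(\<lambda>m. \<Sum>j<J. q (s j - psum (coef (s j)) m)) \<longlonglongrightarrow> (\<Sum>j<J. 0)"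
      by (intro tendsto_sum coef_tendsto s)
    then have "\<forall>\<^sub>F m in sequentially. (\<Sum>j<J. q (s j - psum (coef (s j)) m)) < r/3"
      using order_tendstoD(2) [of _ 0 _ "r/3"] \<open>r > 0\<close> by simp
    then obtain M where M: "\<And>m. m \<ge> M \<Longrightarrow> (\<Sum>j<J. q (s j - psum (coef (s j)) m)) < r/3"
      by (auto simp: eventually_sequentially)
    have "q (x - psum b m) < r" if "m \<ge> M" for m
    proof -
      let ?A = "x - (\<Sum>k<J. s k)" and ?B = "\<Sum>j<J. s j - psum (coef (s j)) m"
        and ?C = "psum b m - (\<Sum>j<J. psum (coef (s j)) m)"
      have V: "?A \<in> V" "?B \<in> V" "?C \<in> V" using x s by (auto intro!: V_sum)
      have "q (x - psum b m) = q ((?A + ?B) - ?C)"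
        by (simp add: sum_subtractf)
      also have "\<dots> \<le> q (?A + ?B) + q ?C"
        by (intro q_diff V_closed V)
      also have "\<dots> \<le> q ?A + q ?B + q ?C"
        using q_add [of ?A ?B] V by auto
      also have "q ?B \<le> (\<Sum>j<J. q (s j - psum (coef (s j)) m))"
        using s by (intro q_sum) auto
      finally show ?thesis using M [OF that] J tail [of m J] by linarith
    qed
    then show "\<exists>no. \<forall>m\<ge>no. norm (q (x - psum b m) - 0) < r"
      using x q_nonneg by (intro exI [of _ M]) auto
  qed
  \<comment> \<open>At \<open>J = 0\<close> the tail estimate bounds every partial sum of
    \<open>b\<close> itself.\<close>
  then show ?thesis
    using tail [of _ 0] by (intro max_psum_least) (simp add: T_def)
qed

text \<open>Zabreiko's lemma makes the partial sum projections uniformly bounded, and two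
  consecutive partial sums isolate one coefficient.\<close>

lemma coef_bounded:
  "\<exists>C>0. \<forall>z\<in>V. \<bar>coef z n\<bar> \<le> C * q z"
proof -
  obtain K where K: "0 \<le> K" "\<And>z. z \<in> V \<Longrightarrow> max_psum z \<le> K * q z"
    using zabreiko [OF max_psum_add max_psum_scale max_psum_series] by blast
  show ?thesis
  proof (intro exI conjI ballI)
    show "0 < 2 / q (e n) * (K + 1)"
      using q_basis_pos [of n] K by simp
    fix z assume z: "z \<in> V"
    have "\<bar>coef z n\<bar> \<le> 2 / q (e n) * max_psum z" by (rule coef_le_max_psum [OF z])
    also have "\<dots> \<le> 2 / q (e n) * ((K + 1) * q z)"
      using K(2) [OF z] q_nonneg [OF z] q_basis_pos [of n]
      by (intro mult_left_mono) (auto simp: algebra_simps)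
    finally show "\<bar>coef z n\<bar> \<le> 2 / q (e n) * (K + 1) * q z" by (simp only: mult.assoc)
  qed
qed

lemma coef_tendsto_of_tendsto:
  assumes "x \<in> V" "\<And>n. s n \<in> V" "(\<lambda>n. q (x - s n)) \<longlonglongrightarrow> 0"
  shows "(\<lambda>n. coef (s n) i) \<longlonglongrightarrow> coef x i"
proof -
  obtain C where C: "\<And>z. z \<in> V \<Longrightarrow> \<bar>coef z i\<bar> \<le> C * q z"
    using coef_bounded [of i] by blast
  have "(\<lambda>n. coef (s n) i - coef x i) \<longlonglongrightarrow> 0"
  proof (rule Lim_null_comparison)
    show "\<forall>\<^sub>F n in sequentially. norm (coef (s n) i - coef x i) \<le> C * q (x - s n)"
      using C [of "x - s _"] assms by (auto simp: coef_diff abs_minus_commute)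
    show "(\<lambda>n. C * q (x - s n)) \<longlonglongrightarrow> 0"
      using assms(3) by (rule tendsto_mult_right_zero)
  qed
  then show ?thesis by (rule LIM_zero_cancel)
qed

end

section \<open>Sums of finite-dimensional blocks\<close>

locale block_norms =
  fixes d :: "nat \<Rightarrow> nat" and \<nu> :: "nat \<Rightarrow> (nat \<Rightarrow> real) \<Rightarrow> real"
  assumes block_data: "block_data d \<nu>"
begin

text \<open>Each block norm is read as a seminorm on all sequences, so that the seminormed locale
  applies with carrier \<open>UNIV\<close>.\<close>

definition blk :: "nat \<Rightarrow> (nat \<Rightarrow> real) \<Rightarrow> real" where
  "blk k a = \<nu> k (block d a k)"

abbreviation "off \<equiv> block_offset d"

lemma \<nu>_norm:
  shows \<nu>_cong: "(\<And>i. i < d k \<Longrightarrow> v i = w i) \<Longrightarrow> \<nu> k v = \<nu> k w"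
    and \<nu>_add: "\<nu> k (\<lambda>i. v i + w i) \<le> \<nu> k v + \<nu> k w"
    and \<nu>_scale: "\<nu> k (\<lambda>i. c * v i) = \<bar>c\<bar> * \<nu> k v"
proof -
  have "is_norm_Rn (d k) (\<nu> k)"
    using block_data by (simp add: block_data_def)
  then show "(\<And>i. i < d k \<Longrightarrow> v i = w i) \<Longrightarrow> \<nu> k v = \<nu> k w"
    "\<nu> k (\<lambda>i. v i + w i) \<le> \<nu> k v + \<nu> k w" "\<nu> k (\<lambda>i. c * v i) = \<bar>c\<bar> * \<nu> k v"
    unfolding is_norm_Rn_def by blast+
qed

sublocale blk: seminormed_subspace UNIV "blk k" for k
proof
  show "blk k (x + y) \<le> blk k x + blk k y" for x y
    using \<nu>_add [of k "block d x k" "block d y k"] by (simp add: blk_def block_def)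
  show "blk k (c *\<^sub>R x) = \<bar>c\<bar> * blk k x" for c x
    using \<nu>_scale [of k c "block d x k"] by (simp add: blk_def block_def)
qed auto

lemma off_Suc: "off (Suc k) = off k + d k"
  by (simp add: block_offset_def)

lemma off_mono: "k \<le> l \<Longrightarrow> off k \<le> off l"
  unfolding block_offset_def by (intro sum_mono2) auto

text \<open>Blocks may be empty, but infinitely many are not: once \<open>Z\<close> nonempty blocks
  precede \<open>k\<close>, the offset is at least \<open>Z\<close>.\<close>

lemma off_at_top: "filterlim off at_top sequentially"
  unfolding filterlim_at_top eventually_sequentially
proof
  fix Z
  have "finite {k. 0 < d k} \<Longrightarrow> False"
    using block_data by (simp add: block_data_def)
  then obtain A where A: "A \<subseteq> {k. 0 < d k}" "finite A" "card A = Z"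
    using infinite_arbitrarily_large by blast
  have "Z \<le> off k" if "k \<ge> Suc (Max (insert 0 A))" for k
  proof -
    have "A \<subseteq> {..<k}"
    proof
      fix x assume "x \<in> A"
      then have "x \<le> Max (insert 0 A)" using A by auto
      then show "x \<in> {..<k}" using that by simp
    qed
    have "Z = (\<Sum>j\<in>A. 1)" using A by simp
    also have "\<dots> \<le> (\<Sum>j\<in>A. d j)" using A by (intro sum_mono) auto
    also have "\<dots> \<le> off k"
      unfolding block_offset_def using \<open>A \<subseteq> {..<k}\<close> by (intro sum_mono2) auto
    finally show ?thesis .
  qed
  then show "\<exists>N. \<forall>n\<ge>N. Z \<le> off n" by blast
qed

lemma blk_cong: "(\<And>n. \<lbrakk>off k \<le> n; n < off (Suc k)\<rbrakk> \<Longrightarrow> a n = b n) \<Longrightarrow> blk k a = blk k b"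
  unfolding blk_def block_def off_Suc by (rule \<nu>_cong) simp

lemma abs_blk_diff_le: "\<bar>blk k a - blk k b\<bar> \<le> blk k (a - b)"
  using blk.q_add [of "a - b" b k] blk.q_add [of "b - a" a k] blk.q_diff_commute [of a b k] by simp

text \<open>Finite dimension enters here: a block norm is dominated by finitely many coordinates, so
  coordinatewise convergence implies convergence of each block norm. Indices below
  \<open>off k\<close> contribute 0.\<close>

lemma blk_le: "blk k a \<le> (\<Sum>i<off (Suc k). \<bar>a i\<bar> * blk k (\<lambda>n. if n = i then 1 else 0))"
proof -
  have "blk k a = blk k (\<Sum>i<off (Suc k). a i *\<^sub>R (\<lambda>n. if n = i then 1 else 0))"
    by (rule blk_cong) (simp add: sum_fun_apply if_distrib [of "\<lambda>x. _ * x"] cong: if_cong)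
  also have "\<dots> \<le> (\<Sum>i<off (Suc k). blk k (a i *\<^sub>R (\<lambda>n. if n = i then 1 else 0)))"
    by (rule blk.q_sum) auto
  also have "\<dots> = (\<Sum>i<off (Suc k). \<bar>a i\<bar> * blk k (\<lambda>n. if n = i then 1 else 0))"
    by (simp only: blk.q_scale UNIV_I)
  finally show ?thesis .
qed

lemma blk_tendsto:
  assumes "\<And>i. (\<lambda>n. a n i) \<longlonglongrightarrow> b i"
  shows "(\<lambda>n. blk k (a n)) \<longlonglongrightarrow> blk k b"
proof -
  have "(\<lambda>n. blk k (a n) - blk k b) \<longlonglongrightarrow> 0"
  proof (rule Lim_null_comparison)
    have "\<bar>blk k (a n) - blk k b\<bar> \<le> (\<Sum>i<off (Suc k). \<bar>a n i - b i\<bar> * blk k (\<lambda>n. if n = i then 1 else 0))" for n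
      using abs_blk_diff_le [of k "a n" b] blk_le [of k "a n - b"] by simp
    then show "\<forall>\<^sub>F n in sequentially. norm (blk k (a n) - blk k b)
      \<le> (\<Sum>i<off (Suc k). \<bar>a n i - b i\<bar> * blk k (\<lambda>n. if n = i then 1 else 0))" by simp
    have "(\<lambda>n. \<Sum>i<off (Suc k). \<bar>a n i - b i\<bar> * blk k (\<lambda>n. if n = i then 1 else 0))
        \<longlonglongrightarrow> (\<Sum>i<off (Suc k). \<bar>b i - b i\<bar> * blk k (\<lambda>n. if n = i then 1 else 0))"
      by (intro tendsto_intros assms)
    then show "(\<lambda>n. \<Sum>i<off (Suc k). \<bar>a n i - b i\<bar> * blk k (\<lambda>n. if n = i then 1 else 0)) \<longlonglongrightarrow> 0" by simp
  qed
  then show ?thesis by (rule LIM_zero_cancel)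
qed

lemma normD_eq: "normD d \<nu> a = (\<Sum>k. blk k a)"
  by (simp add: normD_def blk_def)

lemma Delta_iff: "a \<in> Delta d \<nu> \<longleftrightarrow> summable (\<lambda>k. blk k a)"
  by (simp add: Delta_def blk_def)

text \<open>Only truncation at block boundaries is controlled by the norm of \<open>\<Delta>\<close>: the unit vectors of the
  blocks need not have a uniform basis constant.\<close>

lemma normD_restrict_blocks:
  assumes "K \<le> L"
  shows "normD d \<nu> (\<lambda>n. if off K \<le> n \<and> n < off L then a n else 0) = (\<Sum>k\<in>{K..<L}. blk k a)"
proof -
  let ?g = "\<lambda>n. if off K \<le> n \<and> n < off L then a n else 0"
  have out: "blk k ?g = 0" if "k \<notin> {K..<L}" for k
  proof -
    have "blk k ?g = blk k 0"
    proof (rule blk_cong)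
      fix n assume "off k \<le> n" "n < off (Suc k)"
      then show "?g n = 0 n"
        using that off_mono [of L k] off_mono [of "Suc k" K] by (cases "k < K") auto
    qed
    then show ?thesis by (simp only: blk.q_0)
  qed
  have "normD d \<nu> ?g = (\<Sum>k\<in>{K..<L}. blk k ?g)"
    unfolding normD_eq by (rule suminf_finite) (use out in auto)
  also have "\<dots> = (\<Sum>k\<in>{K..<L}. blk k a)"
  proof (intro sum.cong refl blk_cong)
    fix k n assume "k \<in> {K..<L}" "off k \<le> n" "n < off (Suc k)"
    then show "?g n = a n" using off_mono [of K k] off_mono [of "Suc k" L] by auto
  qed
  finally show ?thesis .
qed

end

text \<open>The equivalence of \<open>e\<close> with the unit vector basis enters as this
  qualitative membership; \<open>normD_coef_bounded\<close> makes it quantitative.\<close>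

locale block_basis = schauder_basis V q e + block_norms d \<nu>
  for V :: "'a::real_vector set" and q e d \<nu> +
  assumes coef_Delta: "z \<in> V \<Longrightarrow> coef z \<in> Delta d \<nu>"
begin

lemma summable_blk_coef: "z \<in> V \<Longrightarrow> summable (\<lambda>k. blk k (coef z))"
  using coef_Delta Delta_iff by blast

lemma blk_coef_le_normD: "z \<in> V \<Longrightarrow> finite A \<Longrightarrow> (\<Sum>k\<in>A. blk k (coef z)) \<le> normD d \<nu> (coef z)"
  unfolding normD_eq by (intro sum_le_suminf summable_blk_coef) (auto intro: blk.q_nonneg)

text \<open>Zabreiko's lemma again. Countable subadditivity is of Fatou type: a finite sum of block
  norms is continuous along the partial sums of a series, and the bound passes to the sum over all
  blocks.\<close>

lemma normD_coef_bounded: "\<exists>C>0. \<forall>z\<in>V. normD d \<nu> (coef z) \<le> C * q z"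
proof -
  have "\<exists>C\<ge>0. \<forall>z\<in>V. normD d \<nu> (coef z) \<le> C * q z"
  proof (rule zabreiko)
    fix x y assume xy: "x \<in> V" "y \<in> V"
    have "normD d \<nu> (coef (x + y)) \<le> (\<Sum>k. blk k (coef x) + blk k (coef y))"
      unfolding normD_eq using xy
      by (intro suminf_le summable_add summable_blk_coef) (auto simp: coef_add intro: blk.q_add)
    also have "\<dots> = normD d \<nu> (coef x) + normD d \<nu> (coef y)"
      unfolding normD_eq using xy by (intro suminf_add [symmetric] summable_blk_coef)
    finally show "normD d \<nu> (coef (x + y)) \<le> normD d \<nu> (coef x) + normD d \<nu> (coef y)" .
  next
    fix x c assume x: "x \<in> V"
    show "normD d \<nu> (coef (c *\<^sub>R x)) = \<bar>c\<bar> * normD d \<nu> (coef x)"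
      unfolding normD_eq coef_scale [OF x] blk.q_scale [OF UNIV_I]
      by (intro suminf_mult summable_blk_coef x)
  next
    fix x s assume x: "x \<in> V" and s: "\<And>n. s n \<in> V"
      and lim: "(\<lambda>n. q (x - (\<Sum>k<n. s k))) \<longlonglongrightarrow> 0"
      and sm: "summable (\<lambda>n. normD d \<nu> (coef (s n)))"
    have partial: "(\<Sum>k<K. blk k (coef x)) \<le> (\<Sum>n. normD d \<nu> (coef (s n)))" for K
    proof (rule LIMSEQ_le_const2)
      show "(\<lambda>n. \<Sum>k<K. blk k (coef (\<Sum>j<n. s j))) \<longlonglongrightarrow> (\<Sum>k<K. blk k (coef x))"
        using x s lim by (intro tendsto_sum blk_tendsto coef_tendsto_of_tendsto) auto
      have "(\<Sum>k<K. blk k (coef (\<Sum>j<n. s j))) \<le> (\<Sum>n. normD d \<nu> (coef (s n)))" for n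
      proof -
        have "(\<Sum>k<K. blk k (coef (\<Sum>j<n. s j))) \<le> (\<Sum>k<K. \<Sum>j<n. blk k (coef (s j)))"
          using s by (intro sum_mono) (auto simp: coef_sum intro: blk.q_sum)
        also have "\<dots> = (\<Sum>j<n. \<Sum>k<K. blk k (coef (s j)))"
          by (rule sum.swap)
        also have "\<dots> \<le> (\<Sum>j<n. normD d \<nu> (coef (s j)))"
          using s by (intro sum_mono blk_coef_le_normD) auto
        also have "\<dots> \<le> (\<Sum>n. normD d \<nu> (coef (s n)))"
          using blk_coef_le_normD [OF s, of "{}"] by (intro sum_le_suminf sm) auto
        finally show ?thesis .
      qed
      then show "\<exists>N. \<forall>n\<ge>N. (\<Sum>k<K. blk k (coef (\<Sum>j<n. s j))) \<le> (\<Sum>n. normD d \<nu> (coef (s n)))" by blast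
    qed
    show "normD d \<nu> (coef x) \<le> (\<Sum>n. normD d \<nu> (coef (s n)))"
      unfolding normD_eq [of "coef x"] by (intro suminf_le_const summable_blk_coef x partial)
  qed
  then obtain C where C: "C \<ge> 0" "\<And>z. z \<in> V \<Longrightarrow> normD d \<nu> (coef z) \<le> C * q z" by blast
  have "normD d \<nu> (coef z) \<le> (C + 1) * q z" if "z \<in> V" for z
    using C(2) [OF that] q_nonneg [OF that] by (simp add: algebra_simps)
  then show ?thesis using C(1) by (intro exI [of _ "C + 1"]) auto
qed

lemma coordinatewise_convergent_subsequence:
  assumes u: "\<And>n. u n \<in> V" "\<And>n. q (u n) \<le> M"
  shows "\<exists>\<kappa> :: nat \<Rightarrow> nat. strict_mono \<kappa> \<and> (\<forall>i. convergent (\<lambda>n. coef (u (\<kappa> n)) i))"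
proof -
  obtain C where C: "\<And>n. 0 < C n" "\<And>z n. z \<in> V \<Longrightarrow> \<bar>coef z n\<bar> \<le> C n * q z"
    using coef_bounded by metis
  \<comment> \<open>Dividing by \<open>C i\<close> makes the bound independent of the coordinate, as
    the diagonal selection requires.\<close>
  have "norm (coef (u n) i / C i) \<le> M" for n i
  proof -
    have "\<bar>coef (u n) i\<bar> \<le> C i * M"
      using C(2) [OF u(1), of n i] mult_left_mono [OF u(2) [of n] less_imp_le [OF C(1) [of i]]] by linarith
    then show ?thesis using C(1) [of i] by (simp add: field_simps)
  qed
  then show ?thesis
  proof (rule_tac function_convergent_subsequence [of UNIV "\<lambda>n i. coef (u n) i / C i" M])
    fix \<kappa> :: "nat \<Rightarrow> nat" assume \<kappa>: "strict_mono \<kappa>"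
      "\<And>i. i \<in> UNIV \<Longrightarrow> \<exists>l. (\<lambda>n. coef (u (\<kappa> n)) i / C i) \<longlonglongrightarrow> l"
    have "convergent (\<lambda>n. coef (u (\<kappa> n)) i)" for i
    proof -
      obtain l where "(\<lambda>n. coef (u (\<kappa> n)) i / C i) \<longlonglongrightarrow> l" using \<kappa>(2) by blast
      then have "(\<lambda>n. C i * (coef (u (\<kappa> n)) i / C i)) \<longlonglongrightarrow> C i * l"
        by (intro tendsto_intros)
      moreover have "C i \<noteq> 0" using C(1) [of i] by simp
      ultimately show ?thesis by (auto intro: convergentI)
    qed
    with \<kappa>(1) show ?thesis by blast
  qed auto
qed

end

section \<open>Gliding humps and linear growth of signed sums\<close>

lemma sum_consecutive_intervals:
  fixes g :: "nat \<Rightarrow> 'a::comm_monoid_add"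
  assumes "mono K"
  shows "(\<Sum>i<J. \<Sum>k\<in>{K i..<K (Suc i)}. g k) = (\<Sum>k\<in>{K 0..<K J}. g k)"
proof (induction J)
  case (Suc J)
  then show ?case
    using monoD [OF assms, of 0 J] monoD [OF assms, of J "Suc J"]
    by (simp add: sum.atLeastLessThan_concat)
qed simp

text \<open>The set \<open>F\<close> and the signs are left unspecified because the contradicting
  upper bounds hold for every choice of them. The offset \<open>b\<close> absorbs the errors of the
  humps.\<close>

definition signed_sums_grow :: "('a::real_vector \<Rightarrow> real) \<Rightarrow> (nat \<Rightarrow> 'a) \<Rightarrow> bool" where
  "signed_sums_grow q u \<longleftrightarrow> (\<exists>\<delta>>0. \<exists>b. \<forall>J. \<exists>F \<epsilon>. finite F \<and> card F = 2 * J \<and> (\<forall>n. \<epsilon> n \<in> {-1, 1}) \<and>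
    \<delta> * real J - b \<le> q (\<Sum>n\<in>F. \<epsilon> n *\<^sub>R u n))"

lemma signed_sums_growE:
  assumes "signed_sums_grow q u"
  obtains \<delta> b F \<epsilon> where "0 < \<delta>" "\<And>J. finite (F J)" "\<And>J. card (F J) = 2 * J" "\<And>J n. \<epsilon> J n \<in> {-1, 1}"
    "\<And>J. \<delta> * real J - b \<le> q (\<Sum>n\<in>F J. \<epsilon> J n *\<^sub>R u n)"
proof -
  obtain \<delta> b where "\<delta> > 0" and "\<forall>J. \<exists>F \<epsilon>. finite F \<and> card F = 2 * J \<and> (\<forall>n. \<epsilon> n \<in> {-1, 1}) \<and>
    \<delta> * real J - b \<le> q (\<Sum>n\<in>F. \<epsilon> n *\<^sub>R u n)"
    using assms unfolding signed_sums_grow_def by (elim exE conjE) (rule that)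
  from this(2) obtain F \<epsilon> where "\<forall>J. finite (F J) \<and> card (F J) = 2 * J \<and> (\<forall>n. \<epsilon> J n \<in> {-1, 1}) \<and>
    \<delta> * real J - b \<le> q (\<Sum>n\<in>F J. \<epsilon> J n *\<^sub>R u n)"
    unfolding choice_iff by (elim exE) (rule that)
  with \<open>\<delta> > 0\<close> show thesis by (intro that [of \<delta> F \<epsilon> b]) (elim allE conjE, assumption)+
qed

context block_basis
begin

lemma psum_diff_eq:
  assumes "K \<le> L"
  shows "psum a L - psum a K = psum (\<lambda>n. if K \<le> n \<and> n < L then a n else 0) L"
proof -
  have "psum (\<lambda>n. if K \<le> n \<and> n < L then a n else 0) L = (\<Sum>n\<in>{K..<L}. a n *\<^sub>R e n)"
    unfolding psum_def by (rule sum.mono_neutral_cong_right) auto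
  moreover have "psum a L = psum a K + (\<Sum>n\<in>{K..<L}. a n *\<^sub>R e n)"
    unfolding psum_def lessThan_atLeast0 using assms by (simp add: sum.atLeastLessThan_concat)
  ultimately show ?thesis by simp
qed

text \<open>A late \<open>n\<close> makes the finitely many coordinates before \<open>off K\<close>
  small; \<open>L\<close> then cuts the tail of that single expansion. Smallness in block norms
  controls the interference between humps, smallness in \<open>q\<close> guarantees that the middle
  part is large.\<close>

lemma gliding_hump_step:
  assumes f: "\<And>n. f n \<in> V" and null: "\<And>i. (\<lambda>n. coef (f n) i) \<longlonglongrightarrow> 0" and "0 < \<epsilon>" "0 < \<eta>"
  obtains n L where "n > n0" "L > K"
    "(\<Sum>k<K. blk k (coef (f n))) \<le> \<epsilon>" "(\<Sum>k. blk (k + L) (coef (f n))) \<le> \<epsilon>"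
    "q (psum (coef (f n)) (off K)) \<le> \<eta>" "q (f n - psum (coef (f n)) (off L)) \<le> \<eta>"
proof -
  have "(\<lambda>n. blk k (coef (f n))) \<longlonglongrightarrow> blk k 0" for k
    using blk_tendsto [of "\<lambda>n. coef (f n)" 0 k] null by simp
  then have "(\<lambda>n. \<Sum>k<K. blk k (coef (f n))) \<longlonglongrightarrow> (\<Sum>k<K. blk k 0)"
    by (intro tendsto_sum)
  then have "(\<lambda>n. \<Sum>k<K. blk k (coef (f n))) \<longlonglongrightarrow> 0"
    by (simp only: blk.q_0 sum.neutral_const)
  then have 1: "\<forall>\<^sub>F n in sequentially. (\<Sum>k<K. blk k (coef (f n))) < \<epsilon>"
    using \<open>0 < \<epsilon>\<close> by (rule order_tendstoD)
  have "(\<lambda>n. q (psum (coef (f n)) (off K))) \<longlonglongrightarrow> 0"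
  proof (rule tendsto_sandwich [OF _ _ tendsto_const])
    have "(\<lambda>n. \<Sum>i<off K. \<bar>coef (f n) i\<bar> * q (e i)) \<longlonglongrightarrow> (\<Sum>i<off K. \<bar>0\<bar> * q (e i))"
      by (intro tendsto_intros null)
    then show "(\<lambda>n. \<Sum>i<off K. \<bar>coef (f n) i\<bar> * q (e i)) \<longlonglongrightarrow> 0" by simp
    have "q (psum (coef (f n)) (off K)) \<le> (\<Sum>i<off K. q (coef (f n) i *\<^sub>R e i))" for n
      unfolding psum_def by (rule q_sum) auto
    then show "\<forall>\<^sub>F n in sequentially. q (psum (coef (f n)) (off K)) \<le> (\<Sum>i<off K. \<bar>coef (f n) i\<bar> * q (e i))"
      by (simp add: q_scale)
  qed (auto intro!: always_eventually q_nonneg)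
  then have "\<forall>\<^sub>F n in sequentially. q (psum (coef (f n)) (off K)) < \<eta>"
    using \<open>0 < \<eta>\<close> by (rule order_tendstoD)
  from eventually_conj [OF eventually_gt_at_top [of n0] eventually_conj [OF 1 this]]
  obtain n where n: "n > n0" "(\<Sum>k<K. blk k (coef (f n))) < \<epsilon>" "q (psum (coef (f n)) (off K)) < \<eta>"
    by (auto simp: eventually_sequentially)
  have "(\<lambda>L. \<Sum>k. blk (k + L) (coef (f n))) \<longlonglongrightarrow> 0"
    using suminf_exist_split2 [OF summable_blk_coef [OF f]] .
  then have 2: "\<forall>\<^sub>F L in sequentially. (\<Sum>k. blk (k + L) (coef (f n))) < \<epsilon>"
    using \<open>0 < \<epsilon>\<close> by (rule order_tendstoD)
  have "(\<lambda>L. q (f n - psum (coef (f n)) (off L))) \<longlonglongrightarrow> 0"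
    using filterlim_compose [OF coef_tendsto [OF f] off_at_top] .
  then have "\<forall>\<^sub>F L in sequentially. q (f n - psum (coef (f n)) (off L)) < \<eta>"
    using \<open>0 < \<eta>\<close> by (rule order_tendstoD)
  from eventually_conj [OF eventually_gt_at_top [of K] eventually_conj [OF 2 this]]
  obtain L where "L > K" "(\<Sum>k. blk (k + L) (coef (f n))) < \<epsilon>" "q (f n - psum (coef (f n)) (off L)) < \<eta>"
    by (auto simp: eventually_sequentially)
  with n show thesis by (intro that [of n L]) auto
qed

lemma gliding_hump:
  assumes f: "\<And>n. f n \<in> V" and null: "\<And>i. (\<lambda>n. coef (f n) i) \<longlonglongrightarrow> 0" and "0 < \<eta>"
  shows "\<exists>\<sigma> K :: nat \<Rightarrow> nat. strict_mono \<sigma> \<and> strict_mono K \<and> (\<forall>j.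
    (\<Sum>k<K j. blk k (coef (f (\<sigma> j)))) \<le> (1/2) ^ j \<and>
    (\<Sum>k. blk (k + K (Suc j)) (coef (f (\<sigma> j)))) \<le> (1/2) ^ j \<and>
    q (psum (coef (f (\<sigma> j))) (off (K j))) \<le> \<eta> \<and>
    q (f (\<sigma> j) - psum (coef (f (\<sigma> j))) (off (K (Suc j)))) \<le> \<eta>)"
proof -
  define Q where "Q = (\<lambda>j (n0, K) (n, L). n > n0 \<and> L > K \<and>
    (\<Sum>k<K. blk k (coef (f n))) \<le> (1/2) ^ j \<and> (\<Sum>k. blk (k + L) (coef (f n))) \<le> (1/2) ^ j \<and>
    q (psum (coef (f n)) (off K)) \<le> \<eta> \<and> q (f n - psum (coef (f n)) (off L)) \<le> \<eta>)"
  have "\<exists>s. \<forall>j. True \<and> Q j (s j) (s (Suc j))"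
  proof (rule dependent_nat_choice)
    fix x :: "nat \<times> nat" and j :: nat
    obtain n0 K where x: "x = (n0, K)" by fastforce
    obtain n L where "n > n0" "L > K"
      "(\<Sum>k<K. blk k (coef (f n))) \<le> (1/2) ^ j" "(\<Sum>k. blk (k + L) (coef (f n))) \<le> (1/2) ^ j"
      "q (psum (coef (f n)) (off K)) \<le> \<eta>" "q (f n - psum (coef (f n)) (off L)) \<le> \<eta>"
      by (rule gliding_hump_step [OF f null, of "(1/2) ^ j" \<eta> n0 K]) (use \<open>0 < \<eta>\<close> in auto)
    then show "\<exists>y. True \<and> Q j x y" by (intro exI [of _ "(n, L)"]) (simp add: Q_def x)
  qed auto
  then obtain s where s: "\<And>j. Q j (s j) (s (Suc j))" by blast
  \<comment> \<open>The state \<open>s j\<close> holds the cut before hump \<open>j\<close>, while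
    the index chosen for hump \<open>j\<close> is stored in \<open>s (Suc j)\<close>; hence the
    shift in the first component only.\<close>
  then have "strict_mono (\<lambda>j. fst (s (Suc j)))" "strict_mono (\<lambda>j. snd (s j))"
    unfolding strict_mono_Suc_iff by (auto simp: Q_def case_prod_beta)
  moreover have "Q j (s j) (s (Suc j))" for j by (rule s)
  ultimately show ?thesis
    unfolding Q_def case_prod_beta by blast
qed

text \<open>On its own interval, hump \<open>i\<close> contributes at least twice its block norms
  minus those of all humps. Summed over the intervals this is twice the middle masses minus the
  total mass, and the total exceeds the middle masses by at most two geometric sums, each at most 2;
  hence the 4.\<close>

lemma hump_sum_lower_bound:
  assumes f: "\<And>j. f j \<in> V" and K: "mono K"
    and left: "\<And>j. (\<Sum>k<K j. blk k (coef (f j))) \<le> (1/2) ^ j"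
    and right: "\<And>j. (\<Sum>k. blk (k + K (Suc j)) (coef (f j))) \<le> (1/2) ^ j"
    and middle: "\<And>j. \<eta> \<le> (\<Sum>k\<in>{K j..<K (Suc j)}. blk k (coef (f j)))"
  shows "\<eta> * real J - 4 \<le> normD d \<nu> (coef (\<Sum>j<J. f j))"
proof -
  let ?F = "\<Sum>j<J. f j"
  have F: "?F \<in> V" using f by auto
  have total: "(\<Sum>k\<in>{K 0..<K J}. blk k (coef (f j))) \<le>
      (\<Sum>k\<in>{K j..<K (Suc j)}. blk k (coef (f j))) + 2 * (1/2) ^ j" for j
  proof -
    have "(\<Sum>k\<in>{K 0..<K J}. blk k (coef (f j))) \<le> (\<Sum>k. blk k (coef (f j)))"
      using blk_coef_le_normD [OF f] by (simp add: normD_eq)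
    also have "\<dots> = (\<Sum>k. blk (k + K (Suc j)) (coef (f j))) + (\<Sum>k<K (Suc j). blk k (coef (f j)))"
      by (rule suminf_split_initial_segment [OF summable_blk_coef [OF f]])
    also have "(\<Sum>k<K (Suc j). blk k (coef (f j)))
        = (\<Sum>k<K j. blk k (coef (f j))) + (\<Sum>k\<in>{K j..<K (Suc j)}. blk k (coef (f j)))"
      unfolding lessThan_atLeast0 using monoD [OF K, of j "Suc j"] by (simp add: sum.atLeastLessThan_concat)
    finally show ?thesis using left [of j] right [of j] by linarith
  qed
  \<comment> \<open>the triangle inequality, with the full sum over \<open>j\<close> so that it does not depend on the hump\<close>
  have hump: "2 * blk k (coef (f i)) - (\<Sum>j<J. blk k (coef (f j))) \<le> blk k (coef ?F)" if "i < J" for i k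
  proof -
    have "coef (f i) = coef ?F - (\<Sum>j\<in>{..<J} - {i}. coef (f j))"
      using that f by (simp add: coef_sum sum_diff1)
    then have "blk k (coef (f i)) \<le> blk k (coef ?F) + blk k (\<Sum>j\<in>{..<J} - {i}. coef (f j))"
      using blk.q_diff [of "coef ?F" "\<Sum>j\<in>{..<J} - {i}. coef (f j)" k] by simp
    also have "blk k (\<Sum>j\<in>{..<J} - {i}. coef (f j)) \<le> (\<Sum>j\<in>{..<J} - {i}. blk k (coef (f j)))"
      by (rule blk.q_sum) auto
    also have "\<dots> = (\<Sum>j<J. blk k (coef (f j))) - blk k (coef (f i))"
      using that by (simp add: sum_diff1)
    finally show ?thesis by simp
  qed
  have geo: "(\<Sum>j<J. (1/2::real) ^ j) \<le> 2"
    by (simp add: sum_gp_strict)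
  have "\<eta> * real J - 4 \<le> (\<Sum>j<J. \<eta>) - 2 * (\<Sum>j<J. (1/2) ^ j)"
    using geo by simp
  also have "\<dots> \<le> (\<Sum>j<J. \<Sum>k\<in>{K j..<K (Suc j)}. blk k (coef (f j))) - 2 * (\<Sum>j<J. (1/2) ^ j)"
    using middle by (intro diff_right_mono sum_mono)
  also have "\<dots> = 2 * (\<Sum>j<J. \<Sum>k\<in>{K j..<K (Suc j)}. blk k (coef (f j)))
      - (\<Sum>j<J. (\<Sum>k\<in>{K j..<K (Suc j)}. blk k (coef (f j))) + 2 * (1/2) ^ j)"
    by (simp add: sum.distrib sum_distrib_left)
  also have "\<dots> \<le> 2 * (\<Sum>j<J. \<Sum>k\<in>{K j..<K (Suc j)}. blk k (coef (f j)))
      - (\<Sum>j<J. \<Sum>k\<in>{K 0..<K J}. blk k (coef (f j)))"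
    by (intro diff_left_mono sum_mono total)
  also have "(\<Sum>j<J. \<Sum>k\<in>{K 0..<K J}. blk k (coef (f j))) = (\<Sum>k\<in>{K 0..<K J}. \<Sum>j<J. blk k (coef (f j)))"
    by (rule sum.swap)
  \<comment> \<open>The hump intervals partition the blocks from \<open>K 0\<close> to
    \<open>K J\<close>, so the total mass can be charged hump by hump.\<close>
  also have "\<dots> = (\<Sum>i<J. \<Sum>k\<in>{K i..<K (Suc i)}. \<Sum>j<J. blk k (coef (f j)))"
    by (rule sum_consecutive_intervals [OF K, symmetric])
  also have "2 * (\<Sum>j<J. \<Sum>k\<in>{K j..<K (Suc j)}. blk k (coef (f j))) - \<dots>
      = (\<Sum>i<J. \<Sum>k\<in>{K i..<K (Suc i)}. 2 * blk k (coef (f i)) - (\<Sum>j<J. blk k (coef (f j))))"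
    by (simp add: sum_subtractf sum_distrib_left)
  also have "\<dots> \<le> (\<Sum>i<J. \<Sum>k\<in>{K i..<K (Suc i)}. blk k (coef ?F))"
    by (intro sum_mono hump) auto
  also have "\<dots> = (\<Sum>k\<in>{K 0..<K J}. blk k (coef ?F))"
    by (rule sum_consecutive_intervals [OF K])
  also have "\<dots> \<le> normD d \<nu> (coef ?F)"
    by (rule blk_coef_le_normD [OF F]) simp
  finally show ?thesis .
qed

text \<open>The seminorm \<open>r\<close> carries the separation and is bounded by the norm of
  \<Delta> (synthesis), which forces each hump to have large block mass. The norm \<open>q\<close>
  bounds the coefficient map, which carries the growth of that mass back to the space.\<close>

theorem signed_sums_grow_linearly:
  fixes r :: "'a \<Rightarrow> real" and u :: "nat \<Rightarrow> 'a"
  assumes r: "seminormed_subspace V r" and r_le_q: "\<And>z. z \<in> V \<Longrightarrow> r z \<le> q z"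
    and r_le_normD: "\<And>a m. (\<And>i. i \<ge> m \<Longrightarrow> a i = 0) \<Longrightarrow> r (psum a m) \<le> B * normD d \<nu> a" and "0 < B"
    and u: "\<And>n. u n \<in> V" "\<And>n. q (u n) \<le> M"
    and "0 < c" and sep: "\<And>m n. m \<noteq> n \<Longrightarrow> c \<le> r (u m - u n)"
  shows "signed_sums_grow q u"
proof -
  interpret r: seminormed_subspace V r by (rule r)
  obtain \<kappa> where \<kappa>: "strict_mono \<kappa>" "\<And>i. convergent (\<lambda>n. coef (u (\<kappa> n)) i)"
    using coordinatewise_convergent_subsequence [of u M] u by blast
  \<comment> \<open>Differences of consecutive terms cancel the coordinatewise limit and keep the
    separation.\<close>
  define f where "f j = u (\<kappa> (2 * j + 1)) - u (\<kappa> (2 * j))" for j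
  have f: "f j \<in> V" for j using u by (auto simp: f_def)
  have null: "(\<lambda>n. coef (f n) i) \<longlonglongrightarrow> 0" for i
  proof -
    obtain l where l: "(\<lambda>n. coef (u (\<kappa> n)) i) \<longlonglongrightarrow> l" using \<kappa>(2) by (auto simp: convergent_def)
    have "(\<lambda>j. coef (u (\<kappa> (2 * j + 1))) i) \<longlonglongrightarrow> l" "(\<lambda>j. coef (u (\<kappa> (2 * j))) i) \<longlonglongrightarrow> l"
      using LIMSEQ_subseq_LIMSEQ [OF l, of "\<lambda>j. 2 * j + 1"] LIMSEQ_subseq_LIMSEQ [OF l, of "\<lambda>j. 2 * j"]
      by (auto simp: strict_mono_def o_def)
    from tendsto_diff [OF this] show ?thesis using u by (simp add: f_def coef_diff)
  qed
  obtain \<sigma> K :: "nat \<Rightarrow> nat" where \<sigma>: "strict_mono \<sigma>" and K: "strict_mono K"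
    and left: "\<And>j. (\<Sum>k<K j. blk k (coef (f (\<sigma> j)))) \<le> (1/2) ^ j"
    and right: "\<And>j. (\<Sum>k. blk (k + K (Suc j)) (coef (f (\<sigma> j)))) \<le> (1/2) ^ j"
    and head: "\<And>j. q (psum (coef (f (\<sigma> j))) (off (K j))) \<le> c/4"
    and tail: "\<And>j. q (f (\<sigma> j) - psum (coef (f (\<sigma> j))) (off (K (Suc j)))) \<le> c/4"
    using gliding_hump [of f "c/4"] f null \<open>0 < c\<close> by (metis divide_pos_pos zero_less_numeral)
  \<comment> \<open>Head and tail cost \<open>c/4\<close> each, so at least \<open>c/2\<close> of
    the separation falls to the middle part, and synthesis has norm at most
    \<open>B\<close>.\<close>
  have middle: "c / (2 * B) \<le> (\<Sum>k\<in>{K j..<K (Suc j)}. blk k (coef (f (\<sigma> j))))" for j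
  proof -
    let ?a = "coef (f (\<sigma> j))" and ?m = "off (K j)" and ?n = "off (K (Suc j))"
    let ?g = "\<lambda>n. if ?m \<le> n \<and> n < ?n then ?a n else 0"
    have KK: "K j \<le> K (Suc j)" using K by (simp add: strict_mono_leD)
    have "c \<le> r (f (\<sigma> j))"
      unfolding f_def using \<kappa>(1) by (intro sep) (simp add: strict_mono_eq)
    also have "f (\<sigma> j) = (f (\<sigma> j) - psum ?a ?n) + ((psum ?a ?n - psum ?a ?m) + psum ?a ?m)"
      by simp
    also have "r \<dots> \<le> r (f (\<sigma> j) - psum ?a ?n) + r ((psum ?a ?n - psum ?a ?m) + psum ?a ?m)"
      using f by (intro r.q_add) auto
    also have "\<dots> \<le> r (f (\<sigma> j) - psum ?a ?n) + (r (psum ?a ?n - psum ?a ?m) + r (psum ?a ?m))"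
      by (intro add_left_mono r.q_add) auto
    also have "r (f (\<sigma> j) - psum ?a ?n) \<le> c/4"
      using r_le_q tail [of j] f by (meson V_closed(3) order_trans psum_in)
    also have "r (psum ?a ?m) \<le> c/4"
      using r_le_q head [of j] by (meson order_trans psum_in)
    also have "psum ?a ?n - psum ?a ?m = psum ?g ?n"
      by (rule psum_diff_eq [OF off_mono [OF KK]])
    also have "r (psum ?g ?n) \<le> B * normD d \<nu> ?g"
      by (rule r_le_normD) auto
    also have "normD d \<nu> ?g = (\<Sum>k\<in>{K j..<K (Suc j)}. blk k ?a)"
      by (rule normD_restrict_blocks [OF KK])
    finally show ?thesis using \<open>0 < B\<close> by (simp add: field_simps)
  qed
  obtain C where C: "C > 0" "\<And>z. z \<in> V \<Longrightarrow> normD d \<nu> (coef z) \<le> C * q z"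
    using normD_coef_bounded by blast
  have grow: "c / (2 * B) / C * real J - 4 / C \<le> q (\<Sum>j<J. f (\<sigma> j))" for J
  proof -
    have "c / (2 * B) * real J - 4 \<le> normD d \<nu> (coef (\<Sum>j<J. f (\<sigma> j)))"
      by (rule hump_sum_lower_bound [OF f strict_mono_mono [OF K] left right middle])
    also have "\<dots> \<le> C * q (\<Sum>j<J. f (\<sigma> j))"
      using f by (intro C) auto
    finally show ?thesis using C(1) by (simp add: field_simps)
  qed
  have "\<exists>F \<epsilon>. finite F \<and> card F = 2 * J \<and> (\<forall>n. \<epsilon> n \<in> {-1, 1}) \<and>
    (\<Sum>n\<in>F. \<epsilon> n *\<^sub>R u n) = (\<Sum>j<J. f (\<sigma> j))" for J
  proof -
    \<comment> \<open>Positive signs sit at odd and negative signs at even positions of the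
      subsequence; the parity makes all \<open>2 * J\<close> terms distinct.\<close>
    define P where "P = (\<lambda>j. \<kappa> (2 * \<sigma> j + 1)) ` {..<J}"
    define N where "N = (\<lambda>j. \<kappa> (2 * \<sigma> j)) ` {..<J}"
    define \<epsilon> :: "nat \<Rightarrow> real" where "\<epsilon> n = (if n \<in> P then 1 else -1)" for n
    have inj: "inj_on (\<lambda>j. \<kappa> (2 * \<sigma> j + 1)) {..<J}" "inj_on (\<lambda>j. \<kappa> (2 * \<sigma> j)) {..<J}"
      using \<kappa>(1) \<sigma> by (auto simp: inj_on_def strict_mono_eq)
    have "2 * m + 1 \<noteq> 2 * n" for m n :: nat by presburger
    then have disj: "P \<inter> N = {}"
      using \<kappa>(1) by (auto simp: P_def N_def strict_mono_eq simp del: Suc_eq_plus1 add_Suc_right)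
    have fin: "finite P" "finite N" by (auto simp: P_def N_def)
    have "(\<Sum>n\<in>P \<union> N. \<epsilon> n *\<^sub>R u n) = (\<Sum>n\<in>P. \<epsilon> n *\<^sub>R u n) + (\<Sum>n\<in>N. \<epsilon> n *\<^sub>R u n)"
      using fin disj by (rule sum.union_disjoint)
    also have "(\<Sum>n\<in>P. \<epsilon> n *\<^sub>R u n) = (\<Sum>n\<in>P. u n)"
      by (intro sum.cong) (auto simp: \<epsilon>_def)
    also have "(\<Sum>n\<in>N. \<epsilon> n *\<^sub>R u n) = (\<Sum>n\<in>N. - u n)"
      using disj by (intro sum.cong) (auto simp: \<epsilon>_def)
    also have "(\<Sum>n\<in>P. u n) + (\<Sum>n\<in>N. - u n) = (\<Sum>j<J. f (\<sigma> j))"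
      unfolding P_def N_def sum.reindex [OF inj(1)] sum.reindex [OF inj(2)]
      by (simp add: f_def sum_subtractf sum_negf)
    finally have "(\<Sum>n\<in>P \<union> N. \<epsilon> n *\<^sub>R u n) = (\<Sum>j<J. f (\<sigma> j))" .
    moreover have "card (P \<union> N) = 2 * J"
      using card_Un_disjoint [OF fin disj] card_image [OF inj(1)] card_image [OF inj(2)]
      by (simp add: P_def N_def)
    ultimately show ?thesis using fin by (intro exI [of _ "P \<union> N"] exI [of _ \<epsilon>]) (auto simp: \<epsilon>_def)
  qed
  then have "\<exists>F \<epsilon>. finite F \<and> card F = 2 * J \<and> (\<forall>n. \<epsilon> n \<in> {-1, 1}) \<and>
    c / (2 * B) / C * real J - 4 / C \<le> q (\<Sum>n\<in>F. \<epsilon> n *\<^sub>R u n)" for J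
    using grow [of J] by metis
  moreover have "c / (2 * B) / C > 0" using \<open>0 < c\<close> \<open>0 < B\<close> C by simp
  ultimately show ?thesis unfolding signed_sums_grow_def by blast
qed

end

section \<open>Symmetric spaces\<close>

lemma space_M01 [simp]: "space M01 = {0..1}"
  by (simp add: M01_def)

lemma sets_M01: "A \<in> sets M01 \<longleftrightarrow> A \<in> sets lebesgue \<and> A \<subseteq> {0..1}"
  by (auto simp: M01_def sets_restrict_space_iff)

interpretation M01: finite_measure M01
  unfolding M01_def by (rule finite_measure_lebesgue_on) simp

lemma measure_M01_Icc: "\<lbrakk>0 \<le> a; a \<le> b; b \<le> 1\<rbrakk> \<Longrightarrow> measure M01 {a..b} = b - a"
  by (simp add: M01_def measure_restrict_space)

lemma measure_M01_Ioc: "\<lbrakk>0 \<le> a; a \<le> b; b \<le> 1\<rbrakk> \<Longrightarrow> measure M01 {a<..b} = b - a"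
  by (subst M01_def, subst measure_restrict_space) auto

lemma Icc_in_sets_M01: "\<lbrakk>0 \<le> a; b \<le> 1\<rbrakk> \<Longrightarrow> {a..b} \<in> sets M01"
  by (auto simp: sets_M01)

lemma measure_M01_le_1: "measure M01 A \<le> 1"
  using M01.bounded_measure [of A] measure_M01_Icc [of 0 1] by simp

lemma equimeasurable_indicator:
  assumes "A \<in> sets M01" "B \<in> sets M01" "measure M01 A = measure M01 B"
  shows "equimeasurable (indicator A) (indicator B)"
  unfolding equimeasurable_def
proof
  fix \<tau> :: real
  have *: "{t \<in> space M01. indicator S t > \<tau>} = (if \<tau> < 0 then space M01 else if \<tau> < 1 then S else {})"
    if "S \<in> sets M01" for S
    using sets.sets_into_space [OF that] by (auto simp: indicator_def)
  show "emeasure M01 {t \<in> space M01. indicator A t > \<tau>} = emeasure M01 {t \<in> space M01. indicator B t > \<tau>}"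
    unfolding * [OF assms(1)] * [OF assms(2)] using assms by (simp add: M01.emeasure_eq_measure)
qed

lemma integrable_M01_continuous:
  fixes f :: "real \<Rightarrow> real"
  shows "continuous_on {0..1} f \<Longrightarrow> integrable M01 f"
  unfolding M01_def by (rule continuous_imp_integrable_real)

lemma integral_M01_eqI:
  fixes f :: "real \<Rightarrow> real"
  assumes "continuous_on {0..1} f" "(f has_integral I) {0..1}"
  shows "integral\<^sup>L M01 f = I"
  using lebesgue_integral_eq_integral [of "{0..1}" f] integrable_M01_continuous [OF assms(1)] assms(2)
  by (auto simp: M01_def integral_unique)

text \<open>The shift to \<open>Suc n\<close> excludes the constant function, so all members have
  the same square integral 1/2.\<close>

definition cosine :: "nat \<Rightarrow> real \<Rightarrow> real" where
  "cosine n t = cos (2 * pi * real (Suc n) * t)"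

lemma continuous_on_cosine [continuous_intros]: "continuous_on S (cosine n)"
  unfolding cosine_def by (intro continuous_intros)

lemma abs_cosine_le_1: "\<bar>cosine n t\<bar> \<le> 1"
  by (simp add: cosine_def)

lemma integral_cos_int:
  fixes k :: int
  assumes "k \<noteq> 0"
  shows "((\<lambda>t. cos (2 * pi * of_int k * t)) has_integral 0) {0..1}"
proof -
  let ?F = "\<lambda>t. sin (2 * pi * of_int k * t) / (2 * pi * of_int k)"
  have "((\<lambda>t. cos (2 * pi * of_int k * t)) has_integral ?F 1 - ?F 0) {0..1}"
  proof (rule fundamental_theorem_of_calculus)
    fix t :: real
    have "(?F has_real_derivative cos (2 * pi * of_int k * t)) (at t within {0..1})"
      using assms by (auto intro!: derivative_eq_intros)
    then show "(?F has_vector_derivative cos (2 * pi * of_int k * t)) (at t within {0..1})"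
      by (simp add: has_real_derivative_iff_has_vector_derivative)
  qed simp
  moreover have "sin (2 * pi * of_int k) = 0"
    using sin_int_2pin [of k] by (simp add: mult.commute)
  ultimately show ?thesis by simp
qed

lemma integral_cosine_mult:
  "integral\<^sup>L M01 (\<lambda>t. cosine m t * cosine n t) = (if m = n then 1/2 else 0)"
proof (rule integral_M01_eqI)
  have prod: "cosine m t * cosine n t =
    (cos (2 * pi * of_int (int m - int n) * t) + cos (2 * pi * of_int (int m + int n + 2) * t)) / 2" for t
    unfolding cosine_def cos_times_cos by (simp add: algebra_simps)
  have plus: "((\<lambda>t. cos (2 * pi * of_int (int m + int n + 2) * t)) has_integral 0) {0..1}"
    by (rule integral_cos_int) simp
  have minus: "((\<lambda>t. cos (2 * pi * of_int (int m - int n) * t)) has_integral (if m = n then 1 else 0)) {0..1}"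
    using integral_cos_int [of "int m - int n"] has_integral_const_real [of "1::real" 0 1] by auto
  show "((\<lambda>t. cosine m t * cosine n t) has_integral (if m = n then 1/2 else 0)) {0..1}"
    using has_integral_divide [OF has_integral_add [OF minus plus], of 2]
    unfolding prod by (simp split: if_splits)
qed (intro continuous_intros)

lemma integral_square_cosine_sum:
  assumes "finite F"
  shows "integral\<^sup>L M01 (\<lambda>t. (\<Sum>n\<in>F. c n * cosine n t)\<^sup>2) = (\<Sum>n\<in>F. (c n)\<^sup>2) / 2"
proof -
  have int: "integrable M01 (\<lambda>t. c m * c n * (cosine m t * cosine n t))" for m n
    by (intro integrable_M01_continuous continuous_intros)
  have "(\<Sum>n\<in>F. c n * cosine n t)\<^sup>2 = (\<Sum>m\<in>F. \<Sum>n\<in>F. c m * c n * (cosine m t * cosine n t))" for t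
    unfolding power2_eq_square sum_product by (simp add: mult_ac)
  then have "integral\<^sup>L M01 (\<lambda>t. (\<Sum>n\<in>F. c n * cosine n t)\<^sup>2)
      = integral\<^sup>L M01 (\<lambda>t. \<Sum>m\<in>F. \<Sum>n\<in>F. c m * c n * (cosine m t * cosine n t))"
    by (simp only:)
  also have "\<dots> = (\<Sum>m\<in>F. integral\<^sup>L M01 (\<lambda>t. \<Sum>n\<in>F. c m * c n * (cosine m t * cosine n t)))"
    by (intro Bochner_Integration.integral_sum Bochner_Integration.integrable_sum int)
  also have "\<dots> = (\<Sum>m\<in>F. \<Sum>n\<in>F. integral\<^sup>L M01 (\<lambda>t. c m * c n * (cosine m t * cosine n t)))"
    by (intro sum.cong refl Bochner_Integration.integral_sum int)
  also have "\<dots> = (\<Sum>m\<in>F. \<Sum>n\<in>F. c m * c n * (if m = n then 1/2 else 0))"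
    by (simp only: integral_mult_right_zero integral_cosine_mult)
  also have "\<dots> = (\<Sum>m\<in>F. (c m)\<^sup>2 / 2)"
    using assms by (intro sum.cong refl) (simp add: if_distrib [of "\<lambda>x. _ * x"] power2_eq_square cong: if_cong)
  finally show ?thesis by (simp add: sum_divide_distrib)
qed

section \<open>Cosines and dyadic indicators in a symmetric space\<close>

locale symmetric_function_space =
  fixes X :: "(real \<Rightarrow> real) set" and N :: "(real \<Rightarrow> real) \<Rightarrow> real"
  assumes symmetric: "symmetric_space X N"
begin

lemma symmetric_space_parts:
  shows "\<forall>x\<in>X. x \<in> borel_measurable M01"
    and "0 \<in> X" "\<forall>x\<in>X. \<forall>y\<in>X. x + y \<in> X" "\<forall>x\<in>X. \<forall>c::real. c *\<^sub>R x \<in> X"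
    and "\<forall>x\<in>X. N x = 0 \<longleftrightarrow> (AE t in M01. x t = 0)"
    and "\<forall>x\<in>X. \<forall>y\<in>X. N (x + y) \<le> N x + N y" "\<forall>x\<in>X. \<forall>c::real. N (c *\<^sub>R x) = \<bar>c\<bar> * N x"
    and "\<forall>s. (\<forall>n::nat. s n \<in> X) \<and> (\<forall>\<epsilon>>0. \<exists>K. \<forall>m\<ge>K. \<forall>n\<ge>K. N (s m - s n) < \<epsilon>) \<longrightarrow>
        (\<exists>l\<in>X. (\<lambda>n. N (s n - l)) \<longlonglongrightarrow> 0)"
    and "\<forall>y\<in>X. \<forall>x \<in> borel_measurable M01. (AE t in M01. \<bar>x t\<bar> \<le> \<bar>y t\<bar>) \<longrightarrow> x \<in> X \<and> N x \<le> N y"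
    and "\<forall>y\<in>X. \<forall>x \<in> borel_measurable M01. equimeasurable x y \<longrightarrow> x \<in> X \<and> N x = N y"
    and "indicator {0..1} \<in> X" "N (indicator {0..1}) = 1"
  using symmetric
  unfolding symmetric_space_def plus_fun_def zero_fun_def scaleR_fun_def real_scaleR_def fun_diff_def
  by - (elim conjE, assumption)+

lemma measurable_X: "f \<in> X \<Longrightarrow> f \<in> borel_measurable M01"
  using symmetric_space_parts(1) by blast

sublocale seminormed_subspace X N
  using symmetric_space_parts(2-4,6,7) by unfold_locales (auto simp: subspace_def)

lemma N_eq_0_iff: "f \<in> X \<Longrightarrow> N f = 0 \<longleftrightarrow> (AE t in M01. f t = 0)"
  using symmetric_space_parts(5) by blast

lemma ideal:
  assumes "g \<in> X" "f \<in> borel_measurable M01" "\<And>t. t \<in> {0..1} \<Longrightarrow> \<bar>f t\<bar> \<le> \<bar>g t\<bar>"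
  shows ideal_in: "f \<in> X" and ideal_le: "N f \<le> N g"
proof -
  have "AE t in M01. \<bar>f t\<bar> \<le> \<bar>g t\<bar>" using assms(3) by (intro AE_I2) auto
  then show "f \<in> X" "N f \<le> N g"
    using symmetric_space_parts(9) assms(1,2) by blast+
qed

lemmas unit_in = symmetric_space_parts(11) and N_unit = symmetric_space_parts(12)

lemma indicator_in: assumes "A \<in> sets M01" shows "indicator A \<in> X"
  using assms by (intro ideal_in [OF unit_in]) (auto simp: indicator_def)

lemma N_indicator_eq:
  assumes "A \<in> sets M01" "B \<in> sets M01" "measure M01 A = measure M01 B"
  shows "N (indicator A) = N (indicator B)"
  using symmetric_space_parts(10) equimeasurable_indicator [OF assms] indicator_in [OF assms(2)]
    measurable_X [OF indicator_in [OF assms(1)]] by blast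

lemma N_Icc_mono: "\<lbrakk>0 \<le> s; s \<le> s'; s' \<le> 1\<rbrakk> \<Longrightarrow> N (indicator {0..s}) \<le> N (indicator {0..s'})"
  by (rule ideal_le [OF indicator_in [OF Icc_in_sets_M01] measurable_X [OF indicator_in [OF Icc_in_sets_M01]]])
    (auto simp: indicator_def)

text \<open>Rearrangement invariance reduces norms of indicators to the fundamental function of
  \<open>X\<close>, the norm of the indicator of \<open>[0, s]\<close> as a function of
  \<open>s\<close>.\<close>

lemma N_indicator_eq_Icc:
  assumes "A \<in> sets M01"
  shows "N (indicator A) = N (indicator {0..measure M01 A})"
  using measure_M01_le_1 [of A] by (intro N_indicator_eq assms Icc_in_sets_M01) (auto simp: measure_M01_Icc)

lemma continuous_in: assumes "continuous_on {0..1} f" shows "f \<in> X"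
proof -
  have "bounded (f ` {0..1})"
    by (intro compact_imp_bounded compact_continuous_image assms compact_Icc)
  then obtain B where B: "\<forall>x\<in>f ` {0..1}. norm x \<le> B" unfolding bounded_iff by blast
  have meas: "f \<in> borel_measurable M01"
    by (rule borel_measurable_integrable [OF integrable_M01_continuous [OF assms]])
  have in_X: "B *\<^sub>R indicator {0..1} \<in> X" by (intro V_closed unit_in)
  have "\<bar>f t\<bar> \<le> \<bar>(B *\<^sub>R indicator {0..1}) t\<bar>" if "t \<in> {0..1}" for t
    using bspec [OF B imageI [OF that]] that by simp
  then show ?thesis by (rule ideal_in [OF in_X meas])
qed

lemma cosine_in: "cosine n \<in> X"
  by (intro continuous_in continuous_intros)

lemma N_Icc_pos: assumes "0 < s" "s \<le> 1" shows "0 < N (indicator {0..s})"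
proof -
  have in_X: "indicator {0..s} \<in> X" using assms by (intro indicator_in Icc_in_sets_M01) auto
  have "\<not> (AE t in M01. indicator {0..s} t = (0::real))"
  proof
    assume "AE t in M01. indicator {0..s} t = (0::real)"
    then have "AE t in M01. t \<notin> {0..s}" by (auto simp: indicator_def split: if_splits)
    then have "emeasure M01 {0..s} = 0"
      using Icc_in_sets_M01 [of 0 s] assms by (subst (asm) AE_iff_measurable [of "{0..s}"]) auto
    then show False using measure_M01_Icc [of 0 s] assms by (simp add: measure_def)
  qed
  then show ?thesis using N_eq_0_iff [OF in_X] q_nonneg [OF in_X] by simp
qed

text \<open>A converse of Chebyshev's inequality. The difference has square integral 1 and modulus
  at most 2; the part where its square is below 1/4 contributes at most 1/4, so the set where its
  modulus is at least 1/2 has measure at least \<open>(1 - 1/4) / 4 = 3/16\<close>.\<close>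

lemma cosine_separated:
  assumes "m \<noteq> n"
  shows "N (indicator {0..3/16}) / 2 \<le> N (cosine m - cosine n)"
proof -
  let ?f = "cosine m - cosine n"
  define E where "E = {t \<in> space M01. (?f t)\<^sup>2 \<ge> 1/4}"
  have f_in: "?f \<in> X" by (intro V_closed cosine_in)
  have [measurable]: "?f \<in> borel_measurable M01" by (rule measurable_X [OF f_in])
  have E: "E \<in> sets M01" unfolding E_def by measurable
  have sq: "integral\<^sup>L M01 (\<lambda>t. (?f t)\<^sup>2) = 1"
    using integral_square_cosine_sum [of "{m, n}" "\<lambda>i. if i = m then 1 else -1"] assms by simp
  have cont: "continuous_on {0..1} (\<lambda>t. (?f t)\<^sup>2)"
    by (auto intro!: continuous_intros)
  have intE: "integrable M01 (indicator E :: real \<Rightarrow> real)"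
    using E by (intro integrable_real_indicator) (auto simp: M01.emeasure_eq_measure)
  have "integral\<^sup>L M01 (\<lambda>t. (?f t)\<^sup>2) \<le> integral\<^sup>L M01 (\<lambda>t. 1/4 + 4 * indicator E t :: real)"
  proof (rule integral_mono [OF integrable_M01_continuous [OF cont]])
    show "integrable M01 (\<lambda>t. 1/4 + 4 * indicator E t :: real)" using intE by simp
    fix t assume "t \<in> space M01"
    moreover have "\<bar>?f t\<bar> \<le> 2" using abs_cosine_le_1 [of m t] abs_cosine_le_1 [of n t] by simp
    then have "(?f t)\<^sup>2 \<le> 4" using abs_le_square_iff [of "?f t" 2] by simp
    ultimately show "(?f t)\<^sup>2 \<le> 1/4 + 4 * indicator E t" by (auto simp: E_def indicator_def)
  qed
  also have "\<dots> = 1/4 + 4 * measure M01 E"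
  proof -
    have "E \<inter> {0..1} = E" by (auto simp: E_def)
    then show ?thesis using intE measure_M01_Icc [of 0 1] by simp
  qed
  finally have "3/16 \<le> measure M01 E" using sq by simp
  then have "N (indicator {0..3/16}) \<le> N (indicator {0..measure M01 E})"
    using measure_M01_le_1 by (intro N_Icc_mono) auto
  also have "\<dots> = N (indicator E)" by (rule N_indicator_eq_Icc [OF E, symmetric])
  finally have "N (indicator {0..3/16}) / 2 \<le> N ((1/2) *\<^sub>R indicator E)"
    using indicator_in [OF E] by (simp add: q_scale)
  also have "\<dots> \<le> N ?f"
  proof (rule ideal_le [OF f_in])
    show "(1/2) *\<^sub>R (indicator E :: real \<Rightarrow> real) \<in> borel_measurable M01"
      using E by (intro measurable_X V_closed indicator_in)
    fix t :: real
    show "\<bar>((1/2) *\<^sub>R (indicator E :: real \<Rightarrow> real)) t\<bar> \<le> \<bar>?f t\<bar>"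
      using abs_le_square_iff [of "1/2" "?f t"] by (auto simp: E_def indicator_def power2_eq_square)
  qed
  finally show ?thesis .
qed

text \<open>The square integral of the sum is only \<open>J\<close>, so its modulus reaches
  \<open>\<eta> * J\<close> on a set of measure at most \<open>1 / (\<eta>\<^sup>2 * J)\<close>.
  There the trivial bound \<open>2 * J\<close> is multiplied by the norm of a small
  indicator.\<close>

lemma N_cosine_sum_le:
  assumes F: "finite F" "card F = 2 * J" and \<epsilon>: "\<And>n. \<epsilon> n \<in> {-1, 1}"
    and s: "0 \<le> s" "s \<le> 1" and \<eta>: "0 < \<eta>" and J: "0 < J" "1 / (\<eta>\<^sup>2 * real J) \<le> s"
  shows "N (\<Sum>n\<in>F. \<epsilon> n *\<^sub>R cosine n) \<le> (\<eta> + 2 * N (indicator {0..s})) * real J"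
proof -
  let ?f = "\<Sum>n\<in>F. \<epsilon> n *\<^sub>R cosine n"
  have ft: "?f t = (\<Sum>n\<in>F. \<epsilon> n * cosine n t)" for t by (simp add: sum_fun_apply)
  define E where "E = {t \<in> space M01. (\<eta> * real J)\<^sup>2 \<le> (?f t)\<^sup>2}"
  have f_in: "?f \<in> X" by (intro V_sum V_closed cosine_in)
  have fm [measurable]: "?f \<in> borel_measurable M01" by (rule measurable_X [OF f_in])
  have E: "E \<in> sets M01" unfolding E_def by measurable
  have "(\<epsilon> n)\<^sup>2 = 1" for n using \<epsilon> [of n] by auto
  then have sq: "integral\<^sup>L M01 (\<lambda>t. (?f t)\<^sup>2) = real J"
    unfolding ft using integral_square_cosine_sum [OF F(1), of \<epsilon>] F by simp
  have "measure M01 E \<le> integral\<^sup>L M01 (\<lambda>t. (?f t)\<^sup>2) / (\<eta> * real J)\<^sup>2"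
    unfolding E_def
  proof (rule integral_Markov_inequality_measure [where A = "{}"])
    show "integrable M01 (\<lambda>t. (?f t)\<^sup>2)"
      unfolding ft by (intro integrable_M01_continuous continuous_intros)
  qed (use \<eta> J in auto)
  also have "\<dots> = 1 / (\<eta>\<^sup>2 * real J)"
    unfolding sq using J by (simp add: power2_eq_square field_simps)
  also have "\<dots> \<le> s" by (rule J)
  finally have "N (indicator {0..measure M01 E}) \<le> N (indicator {0..s})"
    using s by (intro N_Icc_mono) auto
  then have NE: "N (indicator E) \<le> N (indicator {0..s})"
    by (simp add: N_indicator_eq_Icc [OF E])
  let ?g = "(\<eta> * real J) *\<^sub>R indicator {0..1} + (2 * real J) *\<^sub>R indicator E"
  have "N ?f \<le> N ?g"
  proof (rule ideal_le [OF _ fm])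
    show "?g \<in> X" by (intro V_closed unit_in indicator_in E)
    fix t :: real assume t: "t \<in> {0..1}"
    have "\<bar>\<epsilon> n * cosine n t\<bar> \<le> 1" for n
      using \<epsilon> [of n] abs_cosine_le_1 [of n t] by (auto simp: abs_mult)
    then have "\<bar>?f t\<bar> \<le> (\<Sum>n\<in>F. 1)"
      unfolding ft by (intro order_trans [OF sum_abs] sum_mono)
    then have "\<bar>?f t\<bar> \<le> 2 * real J" using F by simp
    moreover have "\<bar>?f t\<bar> < \<eta> * real J" if "t \<notin> E"
      using that t abs_le_square_iff [of "\<eta> * real J" "?f t"] \<eta> by (auto simp: E_def not_le)
    moreover have "0 \<le> \<eta> * real J" using \<eta> by simp
    ultimately show "\<bar>?f t\<bar> \<le> \<bar>?g t\<bar>" using t by (auto simp: indicator_def)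
  qed
  also have "\<dots> \<le> N ((\<eta> * real J) *\<^sub>R indicator {0..1}) + N ((2 * real J) *\<^sub>R indicator E)"
    by (intro q_add V_closed unit_in indicator_in E)
  also have "\<dots> = \<eta> * real J + 2 * real J * N (indicator E)"
    using \<eta> by (simp add: q_scale unit_in N_unit indicator_in E)
  also have "\<dots> \<le> \<eta> * real J + 2 * real J * N (indicator {0..s})"
    using NE by (intro add_left_mono mult_left_mono) auto
  finally show ?thesis by (simp add: algebra_simps)
qed

text \<open>Half-open intervals make the supports disjoint at every point, so signed sums are
  bounded by 1 in modulus.\<close>

definition dyadic :: "nat \<Rightarrow> real \<Rightarrow> real" where
  "dyadic n = indicator {(1/2) ^ Suc n<..(1/2) ^ n}"

lemma dyadic_sets: "{(1/2) ^ Suc n<..(1/2::real) ^ n} \<in> sets M01"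
proof -
  have "(1/2::real) ^ n \<le> 1" by (simp add: power_le_one)
  moreover have "0 < (1/2::real) ^ Suc n" by simp
  ultimately have "{(1/2) ^ Suc n<..(1/2::real) ^ n} \<subseteq> {0..1}"
    by (intro subsetI) (simp only: greaterThanAtMost_iff atLeastAtMost_iff, linarith)
  then show ?thesis by (simp add: sets_M01)
qed

lemma dyadic_in: "dyadic n \<in> X"
  unfolding dyadic_def by (rule indicator_in [OF dyadic_sets])

lemma dyadic_disjoint:
  assumes "m \<noteq> n" "dyadic m t \<noteq> 0" shows "dyadic n t = 0"
proof -
  have "dyadic n t = 0" if "m < n" "dyadic m t \<noteq> 0" for m n
  proof -
    have "(1/2::real) ^ n \<le> (1/2) ^ Suc m" using that by (intro power_decreasing) auto
    then show ?thesis using that by (auto simp: dyadic_def indicator_def split: if_splits)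
  qed
  from this [of m n] this [of n m] assms show ?thesis by (metis nat_neq_iff)
qed

lemma N_dyadic_sum_le:
  assumes F: "finite F" and \<epsilon>: "\<And>n. \<epsilon> n \<in> {-1, 1}"
  shows "N (\<Sum>n\<in>F. \<epsilon> n *\<^sub>R dyadic n) \<le> 1"
proof -
  have "N (\<Sum>n\<in>F. \<epsilon> n *\<^sub>R dyadic n) \<le> N (indicator {0..1})"
  proof (rule ideal_le [OF unit_in])
    show "(\<Sum>n\<in>F. \<epsilon> n *\<^sub>R dyadic n) \<in> borel_measurable M01"
      by (intro measurable_X V_sum V_closed dyadic_in)
    fix t :: real assume t: "t \<in> {0..1}"
    have "\<bar>\<Sum>n\<in>F. \<epsilon> n * dyadic n t\<bar> \<le> 1"
    proof (cases "\<exists>m\<in>F. dyadic m t \<noteq> 0")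
      case True
      then obtain m where m: "m \<in> F" "dyadic m t \<noteq> 0" by blast
      have "(\<Sum>n\<in>F. \<epsilon> n * dyadic n t) = (\<Sum>n\<in>{m}. \<epsilon> n * dyadic n t)"
        using m F dyadic_disjoint by (intro sum.mono_neutral_right) auto
      then have "(\<Sum>n\<in>F. \<epsilon> n * dyadic n t) = \<epsilon> m * dyadic m t" by simp
      moreover have "dyadic m t \<in> {0, 1}" by (simp add: dyadic_def indicator_def)
      ultimately show ?thesis using \<epsilon> [of m] by auto
    next
      case False
      then have "(\<Sum>n\<in>F. \<epsilon> n * dyadic n t) = 0" by (intro sum.neutral) auto
      then show ?thesis by simp
    qed
    then show "\<bar>(\<Sum>n\<in>F. \<epsilon> n *\<^sub>R dyadic n) t\<bar> \<le> \<bar>indicator {0..1} t\<bar>"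
      using t by (simp add: sum_fun_apply)
  qed
  then show ?thesis by (simp add: N_unit)
qed

text \<open>Disjointness gives
  \<open>\<bar>dyadic m\<bar> \<le> \<bar>dyadic m - dyadic n\<bar>\<close>, and the norm of
  \<open>dyadic m\<close> is the fundamental function at the interval length
  \<open>(1/2) ^ m / 2\<close>.\<close>

lemma dyadic_separated:
  assumes c: "\<And>s. \<lbrakk>0 < s; s \<le> 1\<rbrakk> \<Longrightarrow> c \<le> N (indicator {0..s})" and "m \<noteq> n"
  shows "c \<le> N (dyadic m - dyadic n)"
proof -
  have m: "(1/2::real) ^ m \<le> 1" by (simp add: power_le_one)
  then have "measure M01 {(1/2) ^ Suc m<..(1/2::real) ^ m} = (1/2) ^ m / 2"
    by (subst measure_M01_Ioc) simp_all
  then have "N (dyadic m) = N (indicator {0..(1/2) ^ m / 2})"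
    unfolding dyadic_def by (simp only: N_indicator_eq_Icc [OF dyadic_sets])
  moreover have "c \<le> N (indicator {0..(1/2) ^ m / 2})" using m by (intro c) simp_all
  ultimately have "c \<le> N (dyadic m)" by simp
  also have "\<dots> \<le> N (dyadic m - dyadic n)"
  proof (rule ideal_le)
    fix t
    show "\<bar>dyadic m t\<bar> \<le> \<bar>(dyadic m - dyadic n) t\<bar>"
      using dyadic_disjoint [OF \<open>m \<noteq> n\<close>, of t] by (cases "dyadic m t = 0") auto
  qed (auto intro: dyadic_in measurable_X)
  finally show ?thesis .
qed

end

section \<open>Projective frames\<close>

context block_norms
begin

lemma summable_blk_eventually_eq:
  assumes "\<And>i. i \<ge> m \<Longrightarrow> a i = b i" "summable (\<lambda>k. blk k b)"
  shows "summable (\<lambda>k. blk k a)"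
proof -
  obtain K where K: "\<And>k. k \<ge> K \<Longrightarrow> m \<le> off k"
    using off_at_top by (auto simp: filterlim_at_top eventually_sequentially)
  have "\<forall>\<^sub>F k in sequentially. blk k a = blk k b"
    unfolding eventually_sequentially
  proof (intro exI allI impI)
    fix k assume "k \<ge> K"
    then show "blk k a = blk k b" using K [of k] assms(1) by (intro blk_cong) auto
  qed
  then show ?thesis using summable_cong assms(2) by fast
qed

lemma series_Delta_conv_imp_Delta:
  assumes "series_Delta_conv d \<nu> a"
  shows "a \<in> Delta d \<nu>"
proof -
  obtain \<xi> where \<xi>: "summable (\<lambda>k. blk k \<xi>)"
    and lim: "(\<lambda>m. normD d \<nu> (\<lambda>i. \<xi> i - (if i < m then a i else 0))) \<longlonglongrightarrow> 0"
    using assms by (auto simp: series_Delta_conv_def Delta_iff)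
  \<comment> \<open>Once the truncation passes the end of block \<open>k\<close> it is invisible
    there, so a constant is dominated by norms that tend to 0.\<close>
  have "blk k (\<xi> - a) \<le> 0" for k
  proof (rule LIMSEQ_le_const [OF lim], intro exI allI impI)
    fix m assume m: "off (Suc k) \<le> m"
    let ?b = "\<lambda>i. \<xi> i - (if i < m then a i else 0)"
    \<comment> \<open>\<open>normD\<close> dominates a single block only when its series converges;
      this holds because \<open>?b\<close> coincides with \<open>\<xi>\<close> from \<open>m\<close>
      on.\<close>
    have "summable (\<lambda>k. blk k ?b)"
      by (rule summable_blk_eventually_eq [OF _ \<xi>, of m]) auto
    then have "(\<Sum>j\<in>{k}. blk j ?b) \<le> normD d \<nu> ?b"
      unfolding normD_eq by (intro sum_le_suminf) (auto intro: blk.q_nonneg)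
    moreover have "blk k (\<xi> - a) = blk k ?b"
      using m by (intro blk_cong) auto
    ultimately show "blk k (\<xi> - a) \<le> normD d \<nu> ?b" by simp
  qed
  then have "blk k a = blk k \<xi>" for k
    using abs_blk_diff_le [of k \<xi> a] by (metis abs_le_zero_iff eq_iff_diff_eq_0 order_trans)
  then show ?thesis using \<xi> by (simp add: Delta_iff)
qed

end

text \<open>Duality: a functional \<open>y\<close> of norm at most 1 that norms the finite sum turns
  its norm into the pairing of \<open>a\<close> with the values \<open>y (x n)\<close>, and these
  have dual norm at most \<open>B\<close>.\<close>

lemma (in symmetric_function_space) frame_upper_bound:
  assumes bd: "block_data d \<nu>" and frame: "is_frame X N d \<nu> x"
  shows "\<exists>B>0. \<forall>a m. (\<forall>i\<ge>m. a i = 0) \<longrightarrow> N (\<Sum>n<m. a n *\<^sub>R x n) \<le> B * normD d \<nu> a"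
proof -
  interpret block_norms d \<nu> by unfold_locales (rule bd)
  have x: "x n \<in> X" for n using frame by (simp add: is_frame_def)
  obtain A B where "0 < A" "A \<le> B" and B: "\<And>y. y \<in> dualX X N \<Longrightarrow>
      dual_normD d \<nu> (\<lambda>n. y (x n)) \<le> ereal (B * dual_normX X N y)"
    using frame unfolding is_frame_def by blast
  then have "0 < B" by simp
  have "N (\<Sum>n<m. a n *\<^sub>R x n) \<le> B * normD d \<nu> a" if a: "\<forall>i\<ge>m. a i = 0" for a m
  proof -
    let ?w = "\<Sum>n<m. a n *\<^sub>R x n"
    have w: "?w \<in> X" using x by auto
    obtain y where add: "\<And>f g. \<lbrakk>f \<in> X; g \<in> X\<rbrakk> \<Longrightarrow> y (f + g) = y f + y g"
      and scale: "\<And>f c. f \<in> X \<Longrightarrow> y (c *\<^sub>R f) = c * y f"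
      and bound: "\<And>f. f \<in> X \<Longrightarrow> \<bar>y f\<bar> \<le> N f" and yw: "y ?w = N ?w"
      by (rule norming_functional_exists [OF w]) (rule that)
    have "y \<in> dualX X N"
      unfolding dualX_def mem_Collect_eq
    proof (intro conjI ballI allI exI)
      show "y (\<lambda>t. f t + g t) = y f + y g" if "f \<in> X" "g \<in> X" for f g
        using add [OF that] by (simp add: plus_fun_def)
      show "y (\<lambda>t. c * f t) = c * y f" if "f \<in> X" for f c
        using scale [OF that, of c] by (simp add: scaleR_fun_def)
      show "\<bar>y f\<bar> \<le> 1 * N f" if "f \<in> X" for f using bound [OF that] by simp
    qed
    moreover have "dual_normX X N y \<le> 1"
      unfolding dual_normX_def
    proof (rule cSup_least)
      have "\<bar>y 0\<bar> \<in> {\<bar>y a\<bar> |a. a \<in> X \<and> N a \<le> 1}" using V_closed(1) q_0 by fastforce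
      then show "{\<bar>y a\<bar> |a. a \<in> X \<and> N a \<le> 1} \<noteq> {}" by blast
    qed (use bound in force)
    then have "B * dual_normX X N y \<le> B" using \<open>0 < B\<close> by simp
    ultimately have dual: "dual_normD d \<nu> (\<lambda>n. y (x n)) \<le> ereal B"
      using B [of y] by (meson ereal_less_eq(3) order_trans)
    have y_sum: "y (\<Sum>n<k. a n *\<^sub>R x n) = (\<Sum>n<k. a n * y (x n))" for k
    proof (induction k)
      case 0
      have "y (0 *\<^sub>R 0) = 0 * y 0" by (rule scale [OF V_closed(1)])
      then show ?case by (simp only: lessThan_0 sum.empty scaleR_zero_left mult_zero_left)
    next
      case (Suc k)
      have "y ((\<Sum>n<k. a n *\<^sub>R x n) + a k *\<^sub>R x k) = y (\<Sum>n<k. a n *\<^sub>R x n) + y (a k *\<^sub>R x k)"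
        using x by (intro add) auto
      then show ?case by (simp only: sum.lessThan_Suc Suc scale [OF x])
    qed
    have "summable (\<lambda>k. blk k 0)" by (simp only: blk.q_0 summable_zero)
    then have sm: "summable (\<lambda>k. blk k a)"
      by (rule summable_blk_eventually_eq [rotated, of _ m]) (use a in auto)
    have nonneg: "0 \<le> normD d \<nu> a"
      unfolding normD_eq by (intro suminf_nonneg sm blk.q_nonneg) auto
    \<comment> \<open>Scaling by \<open>t > normD d \<nu> a\<close> puts the sequence into the unit
      ball even if its norm is 0.\<close>
    have le: "N ?w \<le> B * t" if t: "normD d \<nu> a < t" for t
    proof -
      have "t > 0" using t nonneg by linarith
      let ?\<xi> = "(1/t) *\<^sub>R a"
      have "normD d \<nu> ?\<xi> = \<bar>1/t\<bar> * normD d \<nu> a"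
        unfolding normD_eq blk.q_scale [OF UNIV_I] by (rule suminf_mult [OF sm])
      also have "\<dots> \<le> 1" using \<open>t > 0\<close> t by (simp add: field_simps)
      finally have "(m, ?\<xi>) \<in> {(m, \<xi>). (\<forall>i\<ge>m. \<xi> i = 0) \<and> normD d \<nu> \<xi> \<le> 1}"
        using a by simp
      then have "ereal \<bar>\<Sum>i<m. ?\<xi> i * y (x i)\<bar> \<le> dual_normD d \<nu> (\<lambda>n. y (x n))"
        unfolding dual_normD_def by (rule SUP_upper2) simp
      with dual have "ereal \<bar>\<Sum>i<m. ?\<xi> i * y (x i)\<bar> \<le> ereal B" by (rule order_trans [rotated])
      moreover have "(\<Sum>i<m. ?\<xi> i * y (x i)) = N ?w / t"
      proof -
        have "(\<Sum>i<m. ?\<xi> i * y (x i)) = (\<Sum>i<m. a i * y (x i)) / t"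
          by (simp add: sum_divide_distrib)
        then show ?thesis by (simp only: y_sum [symmetric] yw)
      qed
      ultimately have "N ?w / t \<le> B" by (simp only: ereal_less_eq abs_le_iff)
      then show ?thesis using \<open>t > 0\<close> by (simp add: field_simps)
    qed
    show ?thesis
    proof (rule dense_ge)
      fix z assume "B * normD d \<nu> a < z"
      then show "N ?w \<le> z" using le [of "z / B"] \<open>0 < B\<close> by (simp add: field_simps)
    qed
  qed
  then show ?thesis using \<open>0 < B\<close> by blast
qed

lemma psumXY_eq: "psumXY e a m = (\<Sum>n<m. a n *\<^sub>R e n)"
  by (rule prod_eqI) (auto simp: psumXY_def fst_sum snd_sum sum_fun_apply)

lemma diffXY_eq: "diffXY z w = z - w"
  by (rule prod_eqI) (auto simp: diffXY_def)

lemma (in symmetric_function_space) complete_product: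
  "complete_seminormed_subspace {z :: (real \<Rightarrow> real) \<times> 'y::banach. fst z \<in> X} (normXY N)"
proof
  show "subspace {z :: (real \<Rightarrow> real) \<times> 'y. fst z \<in> X}"
    unfolding subspace_def by auto
  show "normXY N (z + w) \<le> normXY N z + normXY N w"
    if "z \<in> {z. fst z \<in> X}" "w \<in> {z. fst z \<in> X}" for z w :: "(real \<Rightarrow> real) \<times> 'y"
    using q_add [of "fst z" "fst w"] norm_triangle_ineq [of "snd z" "snd w"] that by (simp add: normXY_def)
  show "normXY N (c *\<^sub>R z) = \<bar>c\<bar> * normXY N z" if "z \<in> {z. fst z \<in> X}" for c and z :: "(real \<Rightarrow> real) \<times> 'y"
    using q_scale [of "fst z" c] that by (simp add: normXY_def algebra_simps)
  fix s :: "nat \<Rightarrow> (real \<Rightarrow> real) \<times> 'y"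
  assume s: "\<And>n. s n \<in> {z. fst z \<in> X}"
    and cauchy: "\<forall>\<epsilon>>0. \<exists>K. \<forall>m\<ge>K. \<forall>n\<ge>K. normXY N (s m - s n) < \<epsilon>"
  have split: "normXY N (z - w) = N (fst z - fst w) + norm (snd z - snd w)" for z w :: "(real \<Rightarrow> real) \<times> 'y"
    by (simp add: normXY_def)
  have N_nonneg: "0 \<le> N (fst (s m) - fst (s n))" for m n
    using s by (intro q_nonneg) auto
  have "\<forall>\<epsilon>>0. \<exists>K. \<forall>m\<ge>K. \<forall>n\<ge>K. N (fst (s m) - fst (s n)) < \<epsilon>"
    using cauchy unfolding split by (meson add_increasing2 le_less_trans norm_ge_zero order_refl)
  then obtain f where f: "f \<in> X" "(\<lambda>n. N (fst (s n) - f)) \<longlonglongrightarrow> 0"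
    using symmetric_space_parts(8) [rule_format, of "\<lambda>n. fst (s n)"] s by auto
  have "\<forall>\<epsilon>>0. \<exists>K. \<forall>m\<ge>K. \<forall>n\<ge>K. norm (snd (s m) - snd (s n)) < \<epsilon>"
    using cauchy N_nonneg unfolding split by (meson add_increasing le_less_trans order_refl)
  then have "Cauchy (\<lambda>n. snd (s n))" by (simp add: Cauchy_iff)
  then obtain y where "(\<lambda>n. snd (s n)) \<longlonglongrightarrow> y"
    using Cauchy_convergent_iff convergent_def by blast
  then have "(\<lambda>n. norm (snd (s n) - y)) \<longlonglongrightarrow> 0"
    by (simp add: LIM_zero tendsto_norm_zero)
  with f(2) have "(\<lambda>n. N (fst (s n) - f) + norm (snd (s n) - y)) \<longlonglongrightarrow> 0 + 0"
    by (rule tendsto_add)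
  then show "\<exists>l\<in>{z. fst z \<in> X}. (\<lambda>n. normXY N (s n - l)) \<longlonglongrightarrow> 0"
    using f(1) by (intro bexI [of _ "(f, y)"]) (auto simp: split)
qed

theorem theorem5:
  fixes X :: "(real \<Rightarrow> real) set" and N :: "(real \<Rightarrow> real) \<Rightarrow> real"
    and d :: "nat \<Rightarrow> nat" and \<nu> :: "nat \<Rightarrow> (nat \<Rightarrow> real) \<Rightarrow> real"
    and x :: "nat \<Rightarrow> real \<Rightarrow> real"
  assumes "symmetric_space X N"
    and "block_data d \<nu>"
    and "is_frame X N d \<nu> x"
  shows "\<not> (\<exists>e :: nat \<Rightarrow> (real \<Rightarrow> real) \<times> 'y::banach. projective_via X N d \<nu> x e)"
proof
  assume "\<exists>e :: nat \<Rightarrow> (real \<Rightarrow> real) \<times> 'y. projective_via X N d \<nu> x e"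
  then obtain e :: "nat \<Rightarrow> (real \<Rightarrow> real) \<times> 'y" where basis: "is_basis_XY X N e"
    and equiv: "equiv_unit_basis X N d \<nu> e" and proj: "\<And>n. AE t in M01. fst (e n) t = x n t"
    unfolding projective_via_def by blast
  interpret X: symmetric_function_space X N by unfold_locales (rule assms)
  let ?Z = "{z :: (real \<Rightarrow> real) \<times> 'y. fst z \<in> X}"
  have series: "series_XY N e a z \<longleftrightarrow> (\<lambda>m. normXY N (z - (\<Sum>n<m. a n *\<^sub>R e n))) \<longlonglongrightarrow> 0" for a z
    by (simp add: series_XY_def diffXY_eq psumXY_eq)
  interpret Z: complete_seminormed_subspace ?Z "normXY N" by (rule X.complete_product)
  interpret Z: schauder_basis ?Z "normXY N" e
    using basis unfolding is_basis_XY_def series by unfold_locales blast+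
  interpret Z: block_basis ?Z "normXY N" e d \<nu>
  proof unfold_locales
    show bd: "block_data d \<nu>" by (rule assms)
    interpret block_norms d \<nu> by unfold_locales (rule bd)
    fix z assume z: "z \<in> ?Z"
    then have "series_XY N e (Z.coef z) z"
      using Z.coef_tendsto by (simp add: series Z.psum_def)
    then have "series_Delta_conv d \<nu> (Z.coef z)"
      using equiv z unfolding equiv_unit_basis_def by blast
    then show "Z.coef z \<in> Delta d \<nu>" by (rule series_Delta_conv_imp_Delta)
  qed
  have x: "x n \<in> X" for n using assms(3) by (simp add: is_frame_def)
  have e: "fst (e n) \<in> X" for n using basis by (simp add: is_basis_XY_def)
  obtain B where "0 < B" and B: "\<And>a m. \<forall>i\<ge>m. a i = 0 \<Longrightarrow> N (\<Sum>n<m. a n *\<^sub>R x n) \<le> B * normD d \<nu> a"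
    using X.frame_upper_bound [OF assms(2,3)] by blast
  \<comment> \<open>Only the first components of the \<open>e n\<close> are frame vectors, so the
    frame inequality bounds this seminorm of a partial sum.\<close>
  have r: "seminormed_subspace ?Z (\<lambda>z. N (fst z))"
    using Z.subspace X.q_add X.q_scale by unfold_locales auto
  have r_le: "N (fst (Z.psum a m)) \<le> B * normD d \<nu> a" if "\<And>i. i \<ge> m \<Longrightarrow> a i = 0" for a m
  proof -
    \<comment> \<open>The two representatives agree only almost everywhere, so they are exchanged at
      zero cost in \<open>N\<close>.\<close>
    have "N (fst (e n) - x n) = 0" for n
      using X.N_eq_0_iff [of "fst (e n) - x n"] e x proj [of n] by (simp add: X.V_closed)
    then have null: "N (a n *\<^sub>R (fst (e n) - x n)) = 0" for n
      using X.q_scale [of "fst (e n) - x n" "a n"] e x by (simp add: X.V_closed)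
    have eq: "fst (Z.psum a m) = (\<Sum>n<m. a n *\<^sub>R (fst (e n) - x n)) + (\<Sum>n<m. a n *\<^sub>R x n)"
      by (simp add: Z.psum_def fst_sum scaleR_diff_right sum_subtractf)
    have "N (fst (Z.psum a m)) \<le> N (\<Sum>n<m. a n *\<^sub>R (fst (e n) - x n)) + N (\<Sum>n<m. a n *\<^sub>R x n)"
      unfolding eq using e x by (intro X.q_add X.V_sum X.V_closed)
    also have "N (\<Sum>n<m. a n *\<^sub>R (fst (e n) - x n)) \<le> (\<Sum>n<m. N (a n *\<^sub>R (fst (e n) - x n)))"
      using e x by (intro X.q_sum X.V_closed)
    also have "\<dots> = 0" by (simp only: null sum.neutral_const)
    also have "N (\<Sum>n<m. a n *\<^sub>R x n) \<le> B * normD d \<nu> a" using B that by blast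
    finally show ?thesis by simp
  qed
  have grow: "signed_sums_grow N u"
    if u: "\<And>n. u n \<in> X" "\<And>n. N (u n) \<le> 1" and c: "0 < c" "\<And>m n. m \<noteq> n \<Longrightarrow> c \<le> N (u m - u n)"
    for u :: "nat \<Rightarrow> real \<Rightarrow> real" and c
  proof -
    have "(\<Sum>n\<in>F. \<epsilon> n *\<^sub>R (u n, 0 :: 'y)) = ((\<Sum>n\<in>F. \<epsilon> n *\<^sub>R u n), 0)" for F \<epsilon>
      by (rule prod_eqI) (auto simp: fst_sum snd_sum)
    then have "normXY N (\<Sum>n\<in>F. \<epsilon> n *\<^sub>R (u n, 0 :: 'y)) = N (\<Sum>n\<in>F. \<epsilon> n *\<^sub>R u n)" for F \<epsilon>
      by (simp add: normXY_def)
    moreover have "signed_sums_grow (normXY N) (\<lambda>n. (u n, 0 :: 'y))"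
    proof (rule Z.signed_sums_grow_linearly [OF r _ r_le \<open>0 < B\<close> _ _ c(1)])
      show "N (fst z) \<le> normXY N z" for z :: "(real \<Rightarrow> real) \<times> 'y" by (simp add: normXY_def)
      show "normXY N (u n, 0 :: 'y) \<le> 1" for n using u(2) by (simp add: normXY_def)
      show "c \<le> N (fst ((u m, 0 :: 'y) - (u n, 0)))" if "m \<noteq> n" for m n
        using c(2) [OF that] by (simp only: fst_diff fst_conv)
    qed (use u in auto)
    ultimately show ?thesis by (simp only: signed_sums_grow_def)
  qed
  show False
  \<comment> \<open>The dichotomy is whether the fundamental function stays away from 0 near 0. If
    it does, disjoint indicators of small sets do not become small; if not, exceptional sets of
    small measure are negligible in norm.\<close>
  proof (cases "\<exists>c>0. \<forall>s. 0 < s \<and> s \<le> 1 \<longrightarrow> c \<le> N (indicator {0..s})")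
    case True
    then obtain c where c: "c > 0" "\<And>s. \<lbrakk>0 < s; s \<le> 1\<rbrakk> \<Longrightarrow> c \<le> N (indicator {0..s})" by blast
    have "N (X.dyadic n) \<le> 1" for n
      using X.N_dyadic_sum_le [of "{n}" "\<lambda>_. 1"] by simp
    then have "signed_sums_grow N X.dyadic"
      by (intro grow [of X.dyadic c] X.dyadic_in X.dyadic_separated c) auto
    then obtain \<delta> b F \<epsilon> where "\<delta> > 0" and F: "\<And>J. finite (F J)" "\<And>J. card (F J) = 2 * J" "\<And>J n. \<epsilon> J n \<in> {-1, 1}"
      "\<And>J. \<delta> * real J - b \<le> N (\<Sum>n\<in>F J. \<epsilon> J n *\<^sub>R X.dyadic n)"
      by (rule signed_sums_growE) (rule that)
    have "\<delta> * real J - b \<le> 1" for J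
      using F(4) X.N_dyadic_sum_le [OF F(1,3)] by (rule order_trans)
    moreover obtain J :: nat where "real J > (1 + b) / \<delta>" using reals_Archimedean2 by blast
    ultimately show False using \<open>\<delta> > 0\<close> by (auto simp: field_simps not_le [symmetric])
  next
    case False
    have le_1: "N (cosine n) \<le> 1" for n
    proof -
      have "N (cosine n) \<le> N (indicator {0..1})"
        using X.measurable_X [OF X.cosine_in] abs_cosine_le_1 by (intro X.ideal_le X.unit_in) auto
      then show ?thesis by (simp add: X.N_unit)
    qed
    have "0 < N (indicator {0..3/16}) / 2" using X.N_Icc_pos by simp
    then have "signed_sums_grow N cosine"
      using X.cosine_separated by (intro grow [of cosine "N (indicator {0..3/16}) / 2"] X.cosine_in le_1)
    then obtain \<delta> b F \<epsilon> where "\<delta> > 0" and F: "\<And>J. finite (F J)" "\<And>J. card (F J) = 2 * J" "\<And>J n. \<epsilon> J n \<in> {-1, 1}"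
      "\<And>J. \<delta> * real J - b \<le> N (\<Sum>n\<in>F J. \<epsilon> J n *\<^sub>R cosine n)"
      by (rule signed_sums_growE) (rule that)
    \<comment> \<open>With \<open>\<eta> = \<delta> / 4\<close> the indicator term costs less than
      \<eta> as well, so the sum has norm at most \<open>2 * \<eta> * J\<close>, half the growth
      \<open>\<delta> * J\<close>. The choice of \<open>J\<close> then makes the remaining half
      exceed \<open>b\<close> and the exceptional set no larger than \<open>s\<close>.\<close>
    obtain s where s: "0 < s" "s \<le> 1" "N (indicator {0..s}) < \<delta> / 8"
      using False \<open>\<delta> > 0\<close> by (metis divide_pos_pos not_le zero_less_numeral)
    define \<eta> where "\<eta> = \<delta> / 4"
    have "\<eta> > 0" using \<open>\<delta> > 0\<close> by (simp add: \<eta>_def)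
    obtain J :: nat where J: "real J > max (1 / (\<eta>\<^sup>2 * s)) (\<bar>b\<bar> / \<eta>)" using reals_Archimedean2 by blast
    then have "real J > 0" using \<open>\<eta> > 0\<close> s by (smt (verit) divide_nonneg_pos max_def abs_ge_zero)
    have "1 / (\<eta>\<^sup>2 * real J) \<le> s"
      using J \<open>\<eta> > 0\<close> s \<open>real J > 0\<close> by (simp add: field_simps)
    then have "N (\<Sum>n\<in>F J. \<epsilon> J n *\<^sub>R cosine n) \<le> (\<eta> + 2 * N (indicator {0..s})) * real J"
      using F(1-3) s \<open>\<eta> > 0\<close> \<open>real J > 0\<close> by (intro X.N_cosine_sum_le) auto
    also have "\<dots> \<le> (2 * \<eta>) * real J"
      using s by (intro mult_right_mono) (auto simp: \<eta>_def)
    finally have "\<delta> * real J - b \<le> 2 * \<eta> * real J" using F(4) [of J] by linarith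
    then have "2 * (\<eta> * real J) \<le> b" by (simp add: \<eta>_def algebra_simps)
    moreover have "\<bar>b\<bar> < \<eta> * real J" using J \<open>\<eta> > 0\<close> by (simp add: field_simps)
    moreover have "0 < \<eta> * real J" using \<open>\<eta> > 0\<close> \<open>real J > 0\<close> by simp
    ultimately show False using abs_ge_self [of b] by linarith
  qed
qed

end
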